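(* Let $m,n\ge1$ and $r\ge0$ be integers, and suppose that $S\subseteq[m]\times[n]$ contains at most two entries in the $m$th row. Then $\mathrm{mat}_q(m\times n,S,r)$ is equal to a linear combination of similar expressions for smaller matrices with coefficients in $\mathbf Z[q]$. That is, there exist finitely many tuples $(m_t,n_t,S_t,r_t)$ with $0\le m_t\le m$, $0\le n_t\le n$, $(m_t,n_t)\neq(m,n)$, $S_t\subseteq[m_t]\times[n_t]$, $r_t\ge0$, and polynomials $c_t(x)\in\mathbf Z[x]$, all independent of $q$, such that for every prime power $q$ $$\mathrm{mat}_q(m\times n,S,r)=\sum_t c_t(q)\,\mathrm{mat}_q(m_t\times n_t,S_t,r_t).$$
   Context: $[n]=\{1,\dots,n\}$ (and $[0]=\varnothing$). For integers $m,n,r\ge0$ and $S\subseteq[m]\times[n]$, $\mathrm{mat}_q(m\times n,S,r)$ denotes the number of $m\times n$ matrices $A=(a_{ij})$ over the field $\mathbf F_q$ with $q$ elements of rank $r$ such that $a_{ij}=0$ whenever $(i,j)\in S$. If $m=0$ or $n=0$ there is exactly one such (empty) matrix, of rank $0$. *)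

theory Defs
  imports
    "Jordan_Normal_Form.Missing_VectorSpace"
    "HOL-Computational_Algebra.Polynomial"
    "HOL-Number_Theory.Prime_Powers"
begin

text \<open>An \<open>m\<close> by \<open>n\<close> matrix over \<open>F\<close> is an extensional function on \<open>{1..m} \<times> {1..n}\<close>.
  Extensionality makes the cardinality below a count of matrices, and yields exactly one
  matrix when \<open>m = 0\<close> or \<open>n = 0\<close>.\<close>

definition matrices :: "('a, 'b) ring_scheme \<Rightarrow> nat \<Rightarrow> nat \<Rightarrow> (nat \<times> nat \<Rightarrow> 'a) set" where
  "matrices F m n = ({1..m} \<times> {1..n}) \<rightarrow>\<^sub>E carrier F"

definition mat_column :: "nat \<Rightarrow> (nat \<times> nat \<Rightarrow> 'a) \<Rightarrow> nat \<Rightarrow> nat \<Rightarrow> 'a" where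
  "mat_column m A j = (\<lambda>i\<in>{1..m}. A (i, j))"

text \<open>The rank is the dimension of the column space, a subspace of the space of all functions
  from \<open>{1..m}\<close> to \<open>F\<close>.\<close>

definition mat_rank :: "('a, 'b) ring_scheme \<Rightarrow> nat \<Rightarrow> nat \<Rightarrow> (nat \<times> nat \<Rightarrow> 'a) \<Rightarrow> nat" where
  "mat_rank F m n A =
     vectorspace.dim F
       (module.span_vs F (ring.func_space F {1..m}) (mat_column m A ` {1..n}))"

text \<open>Every finite field is isomorphic to one whose carrier is a set of natural numbers, so taking
  \<open>F\<close> over all fields of type \<open>nat ring\<close> with \<open>q\<close> elements covers every model of the field with
  \<open>q\<close> elements. This lets a single formula quantify over all \<open>q\<close>.\<close>

definition matq :: "('a, 'b) ring_scheme \<Rightarrow> nat \<Rightarrow> nat \<Rightarrow> (nat \<times> nat) set \<Rightarrow> nat \<Rightarrow> nat" where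
  "matq F m n S r =
     card {A \<in> matrices F m n. mat_rank F m n A = r \<and> (\<forall>(i, j)\<in>S. A (i, j) = \<zero>\<^bsub>F\<^esub>)}"

end

theory Submission
  imports Defs
begin

text \<open>
  Remove the last row: a matrix \<open>A\<close> consists of a matrix \<open>B\<close> with one row less and a row \<open>v\<close> that
  vanishes on the set \<open>Z\<close> of at most two columns. The rank of \<open>A\<close> is that of \<open>B\<close> if \<open>v\<close> lies in
  the row space of \<open>B\<close>, and one more otherwise (\<open>rank_append_row\<close>). So \<open>matq\<close> for \<open>A\<close> is known once
  the number \<open>a B\<close> of vectors of the row space of \<open>B\<close> that vanish on \<open>Z\<close>, summed over all \<open>B\<close> of a
  given rank, is known (\<open>matq_Suc\<close>).

  The row space is the annihilator of the kernel. A double count of orthogonal pairs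
  (\<open>card_annihilator\<close>) therefore turns \<open>a B\<close> into \<open>q ^ (rank B - |Z|)\<close> times the number of kernel
  vectors of \<open>B\<close> supported on \<open>Z\<close> (\<open>card_row_extensions\<close>). Summed over \<open>B\<close>, this counts pairs
  \<open>(B, x)\<close> with \<open>B x = 0\<close> and \<open>x\<close> supported on \<open>Z\<close>. Fix \<open>x\<close> with support \<open>T \<subseteq> Z\<close>. The relation
  \<open>B x = 0\<close> says that the columns in \<open>T\<close> are proportional if \<open>T\<close> has two elements, and that the column
  is zero if \<open>T\<close> has one. A column operation clears one of the columns and hands its prescribed zeros to
  the other one, and the remaining condition on the matrix is again a zero pattern
  (\<open>card_constrained_null\<close>). There are \<open>(q - 1) ^ |T|\<close> such \<open>x\<close>, all with the same count. Every
  term of the resulting combination thus belongs to matrices with one row less and equally many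
  columns.

  The coefficient \<open>q ^ (rank B - |Z|)\<close> is a polynomial unless the rank of \<open>B\<close> is smaller than
  \<open>|Z|\<close>. In rank \<open>0\<close> always \<open>a B = 1\<close>. In rank \<open>1\<close> with \<open>|Z| = 2\<close>, the number \<open>a B\<close> is \<open>q\<close> or \<open>1\<close>,
  according to whether the columns in \<open>Z\<close> vanish, which is a zero pattern as well.
\<close>

section \<open>Vectors over a finite field\<close>

locale finite_field = field R for R (structure) +
  assumes finite_carrier: "finite (carrier R)"
begin

abbreviation q :: nat where "q \<equiv> card (carrier R)"

abbreviation vecs :: "nat set \<Rightarrow> (nat \<Rightarrow> 'a) set" where
  "vecs J \<equiv> J \<rightarrow>\<^sub>E carrier R"

definition dot :: "nat set \<Rightarrow> (nat \<Rightarrow> 'a) \<Rightarrow> (nat \<Rightarrow> 'a) \<Rightarrow> 'a" where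
  "dot J v x = (\<Oplus>j\<in>J. v j \<otimes> x j)"

text \<open>Closure under \<open>a x + y\<close> alone, together with the zero vector, characterises subspaces.\<close>

definition comb :: "nat set \<Rightarrow> 'a \<Rightarrow> (nat \<Rightarrow> 'a) \<Rightarrow> (nat \<Rightarrow> 'a) \<Rightarrow> nat \<Rightarrow> 'a" where
  "comb J a x y = (\<lambda>j\<in>J. a \<otimes> x j \<oplus> y j)"

definition unit_vec :: "nat set \<Rightarrow> nat \<Rightarrow> nat \<Rightarrow> 'a" where
  "unit_vec J k = (\<lambda>j\<in>J. if j = k then \<one> else \<zero>)"

definition lin_subspace :: "nat set \<Rightarrow> (nat \<Rightarrow> 'a) set \<Rightarrow> bool" where
  "lin_subspace J U \<longleftrightarrow> U \<subseteq> vecs J \<and> (\<lambda>j\<in>J. \<zero>) \<in> U \<and>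
     (\<forall>a\<in>carrier R. \<forall>x\<in>U. \<forall>y\<in>U. comb J a x y \<in> U)"

lemma q_ge_2: "q \<ge> 2"
proof -
  have "card {\<zero>, \<one>} \<le> q"
    by (intro card_mono finite_carrier) auto
  then show ?thesis using zero_not_one by simp
qed

lemma comb_closed: "a \<in> carrier R \<Longrightarrow> x \<in> vecs J \<Longrightarrow> y \<in> vecs J \<Longrightarrow> comb J a x y \<in> vecs J"
  unfolding comb_def by (auto simp: PiE_iff)

lemma unit_vec_closed: "unit_vec J k \<in> vecs J"
  unfolding unit_vec_def by auto

lemma lin_subspaceD:
  assumes "lin_subspace J U"
  shows "U \<subseteq> vecs J" "(\<lambda>j\<in>J. \<zero>) \<in> U"
    "\<And>a x y. a \<in> carrier R \<Longrightarrow> x \<in> U \<Longrightarrow> y \<in> U \<Longrightarrow> comb J a x y \<in> U"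
  using assms unfolding lin_subspace_def by auto

lemma lin_subspace_finite:
  assumes "finite J" "lin_subspace J U"
  shows "finite U"
  using lin_subspaceD(1)[OF assms(2)] assms(1) finite_carrier
  by (meson finite_PiE finite_subset)

lemma dot_closed:
  assumes "v \<in> J \<rightarrow> carrier R" "x \<in> J \<rightarrow> carrier R"
  shows "dot J v x \<in> carrier R"
  unfolding dot_def using assms by (intro finsum_closed) (auto simp: Pi_iff)

lemma dot_commute:
  assumes "v \<in> J \<rightarrow> carrier R" "x \<in> J \<rightarrow> carrier R"
  shows "dot J v x = dot J x v"
  unfolding dot_def using assms by (intro finsum_cong') (auto simp: Pi_iff m_comm)

lemma dot_cong:
  assumes "\<And>j. j \<in> J \<Longrightarrow> v j = v' j" "v' \<in> J \<rightarrow> carrier R" "x \<in> J \<rightarrow> carrier R"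
  shows "dot J v x = dot J v' x"
  unfolding dot_def using assms by (intro finsum_cong') (auto simp: Pi_iff)

lemma dot_comb:
  assumes "finite J" "v \<in> J \<rightarrow> carrier R" "a \<in> carrier R"
    "x \<in> J \<rightarrow> carrier R" "y \<in> J \<rightarrow> carrier R"
  shows "dot J v (comb J a x y) = a \<otimes> dot J v x \<oplus> dot J v y"
proof -
  have "dot J v (comb J a x y) = (\<Oplus>j\<in>J. a \<otimes> (v j \<otimes> x j) \<oplus> v j \<otimes> y j)"
    unfolding dot_def comb_def using assms
    by (intro finsum_cong') (auto simp: Pi_iff r_distr m_lcomm)
  also have "\<dots> = (\<Oplus>j\<in>J. a \<otimes> (v j \<otimes> x j)) \<oplus> (\<Oplus>j\<in>J. v j \<otimes> y j)"
    using assms by (intro finsum_addf) (auto simp: Pi_iff)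
  also have "(\<Oplus>j\<in>J. a \<otimes> (v j \<otimes> x j)) = a \<otimes> (\<Oplus>j\<in>J. v j \<otimes> x j)"
    using assms by (intro finsum_rdistr[symmetric]) (auto simp: Pi_iff)
  finally show ?thesis unfolding dot_def .
qed

lemma dot_zero:
  assumes "v \<in> J \<rightarrow> carrier R"
  shows "dot J v (\<lambda>j\<in>J. \<zero>) = \<zero>"
  unfolding dot_def using assms
  by (simp add: add.finprod_one_eqI Pi_iff)

lemma dot_remove:
  assumes "finite J" "j \<in> J" "v \<in> J \<rightarrow> carrier R" "x \<in> J \<rightarrow> carrier R"
  shows "dot J v x = v j \<otimes> x j \<oplus> dot (J - {j}) v x"
proof -
  have "dot J v x = dot (insert j (J - {j})) v x"
    using assms(2) by (simp add: insert_absorb)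
  also have "\<dots> = v j \<otimes> x j \<oplus> dot (J - {j}) v x"
    unfolding dot_def using assms by (intro finsum_insert) (auto simp: Pi_iff)
  finally show ?thesis .
qed

lemma dot_unit_vec:
  assumes "finite J" "k \<in> J" "v \<in> J \<rightarrow> carrier R"
  shows "dot J v (unit_vec J k) = v k"
proof -
  have "dot (J - {k}) v (unit_vec J k) = \<zero>"
    unfolding dot_def using assms
    by (intro add.finprod_one_eqI) (auto simp: Pi_iff unit_vec_def)
  moreover have "unit_vec J k \<in> J \<rightarrow> carrier R"
    using unit_vec_closed by (auto simp: PiE_iff Pi_iff)
  ultimately show ?thesis
    using assms dot_remove[of J k v "unit_vec J k"] by (auto simp: unit_vec_def Pi_iff)
qed

lemma lin_subspace_vecs: "lin_subspace J (vecs J)"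
  unfolding lin_subspace_def using comb_closed by auto

section \<open>Counting in subspaces\<close>

text \<open>Every nonempty fibre of a linear map is a translate of its kernel, so the fibres over the image
  all have the same size. Linearity enters only through \<open>ker\<close>, so that one lemma serves linear
  functionals as well as matrices.\<close>

lemma card_eq_image_times_kernel:
  assumes fin: "finite J" and U: "lin_subspace J U" and N: "N \<subseteq> U"
    and ker: "\<And>x u. x \<in> U \<Longrightarrow> u \<in> U \<Longrightarrow> f x = f u \<longleftrightarrow> comb J (\<ominus> \<one>) u x \<in> N"
  shows "card U = card (f ` U) * card N"
proof -
  have finU: "finite U" by (rule lin_subspace_finite[OF fin U])
  note subspD = lin_subspaceD[OF U]
  have shift_back: "comb J \<one> u (comb J (\<ominus> \<one>) u x) = x" and shift_forth: "comb J (\<ominus> \<one>) u (comb J \<one> u x) = x"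
    if "u \<in> U" "x \<in> U" for u x
  proof -
    have "u \<in> vecs J" "x \<in> vecs J" using that subspD(1) by auto
    then show "comb J \<one> u (comb J (\<ominus> \<one>) u x) = x" "comb J (\<ominus> \<one>) u (comb J \<one> u x) = x"
      unfolding comb_def
      by (auto intro!: ext simp: PiE_iff extensional_def l_minus r_neg1 r_neg2)
  qed
  have fibre: "card {x \<in> U. f x = f u} = card N" if u: "u \<in> U" for u
  proof -
    have "bij_betw (comb J (\<ominus> \<one>) u) {x \<in> U. f x = f u} N"
    proof (rule bij_betw_byWitness[where f' = "comb J \<one> u"])
      show "\<forall>x\<in>{x \<in> U. f x = f u}. comb J \<one> u (comb J (\<ominus> \<one>) u x) = x"
        using shift_back u by auto
      show "\<forall>x\<in>N. comb J (\<ominus> \<one>) u (comb J \<one> u x) = x"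
        using shift_forth u N by auto
      show "comb J (\<ominus> \<one>) u ` {x \<in> U. f x = f u} \<subseteq> N"
        using ker u by auto
      show "comb J \<one> u ` N \<subseteq> {x \<in> U. f x = f u}"
      proof safe
        fix x assume x: "x \<in> N"
        then show xU: "comb J \<one> u x \<in> U" using subspD(3) u N by auto
        show "f (comb J \<one> u x) = f u"
          using ker[OF xU u] shift_forth[OF u] x N by auto
      qed
    qed
    then show ?thesis by (rule bij_betw_same_card)
  qed
  have "card U = card (\<Union>y\<in>f ` U. {x \<in> U. f x = y})"
    by (rule arg_cong[where f = card]) auto
  also have "\<dots> = (\<Sum>y\<in>f ` U. card {x \<in> U. f x = y})"
    using finU by (intro card_UN_disjoint) auto
  also have "\<dots> = (\<Sum>y\<in>f ` U. card N)"
    by (intro sum.cong) (auto simp: fibre)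
  finally show ?thesis by simp
qed

lemma dot_diff_eq_zero_iff:
  assumes "finite J" "v \<in> J \<rightarrow> carrier R" "x \<in> vecs J" "u \<in> vecs J"
  shows "dot J v (comb J (\<ominus> \<one>) u x) = \<zero> \<longleftrightarrow> dot J v x = dot J v u"
proof -
  have "dot J v (comb J (\<ominus> \<one>) u x) = \<ominus> dot J v u \<oplus> dot J v x"
    using assms dot_closed[of v J u] by (subst dot_comb) (auto simp: PiE_iff l_minus)
  moreover have "\<ominus> a \<oplus> b = \<zero> \<longleftrightarrow> b = a" if "a \<in> carrier R" "b \<in> carrier R" for a b
    using that by (metis l_neg add.inv_closed add.m_comm add.inv_equality minus_minus)
  ultimately show ?thesis
    using assms by (auto simp: dot_closed PiE_iff)
qed

text \<open>A linear functional that does not vanish identically on \<open>U\<close> takes every value, so its kernel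
  is a \<open>q\<close>-th part of \<open>U\<close>.\<close>

lemma card_dot_zero:
  assumes fin: "finite J" and U: "lin_subspace J U" and v: "v \<in> J \<rightarrow> carrier R"
    and u: "u \<in> U" "dot J v u \<noteq> \<zero>"
  shows "card U = q * card {x \<in> U. dot J v x = \<zero>}"
proof -
  note subspD = lin_subspaceD[OF U]
  have "dot J v ` U = carrier R"
  proof (intro equalityI subsetI)
    fix a assume "a \<in> dot J v ` U"
    then show "a \<in> carrier R" using subspD(1) v by (auto simp: PiE_iff intro!: dot_closed)
  next
    fix a assume a: "a \<in> carrier R"
    have uJ: "u \<in> J \<rightarrow> carrier R" using subspD(1) u by (auto simp: PiE_iff)
    let ?c = "a \<otimes> inv (dot J v u)"
    have c: "dot J v u \<in> Units R" using u uJ v by (simp add: field_Units dot_closed)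
    then have "dot J v (comb J ?c u (\<lambda>j\<in>J. \<zero>)) = a"
      using fin v uJ a by (subst dot_comb) (auto simp: dot_zero m_assoc dot_closed)
    then show "a \<in> dot J v ` U"
      using subspD(2,3) u a c by (metis Units_inv_closed imageI m_closed)
  qed
  moreover have "card U = card (dot J v ` U) * card {x \<in> U. dot J v x = \<zero>}"
    using subspD fin v by (intro card_eq_image_times_kernel[OF fin U])
      (auto simp: dot_diff_eq_zero_iff subset_iff)
  ultimately show ?thesis by simp
qed

text \<open>A double count takes the place of the dimension formula for orthogonal complements. Count the
  pairs \<open>(u, v)\<close> with \<open>u \<bullet> v = 0\<close>: an element \<open>v\<close> of the annihilator contributes \<open>|U|\<close> of them,
  and every other \<open>v\<close> contributes \<open>|U| / q\<close>. Equating this with the count by \<open>u\<close>, the terms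
  \<open>|U| |V| / q\<close> cancel and a common factor \<open>q - 1\<close> remains.\<close>

lemma card_annihilator:
  assumes fin: "finite J" and U: "lin_subspace J U" and V: "lin_subspace J V"
  shows "card {v \<in> V. \<forall>u\<in>U. dot J v u = \<zero>} * card U =
         card {u \<in> U. \<forall>v\<in>V. dot J v u = \<zero>} * card V"
proof -
  have gen: "q * (\<Sum>v\<in>V. card {u \<in> U. dot J v u = \<zero>}) + card {v \<in> V. \<forall>u\<in>U. dot J v u = \<zero>} * card U
     = card V * card U + q * card {v \<in> V. \<forall>u\<in>U. dot J v u = \<zero>} * card U"
    if U: "lin_subspace J U" and V: "lin_subspace J V" for U V
  proof -
    have finV: "finite V" by (rule lin_subspace_finite[OF fin V])
    let ?A = "{v \<in> V. \<forall>u\<in>U. dot J v u = \<zero>}"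
    have "(\<Sum>v\<in>V. q * card {u \<in> U. dot J v u = \<zero>}) = (\<Sum>v\<in>?A. q * card {u \<in> U. dot J v u = \<zero>})
       + (\<Sum>v\<in>V - ?A. q * card {u \<in> U. dot J v u = \<zero>})"
      using finV by (subst sum.subset_diff[of ?A]) (auto simp: add.commute)
    also have "(\<Sum>v\<in>?A. q * card {u \<in> U. dot J v u = \<zero>}) = (\<Sum>v\<in>?A. q * card U)"
      by (intro sum.cong refl arg_cong[where f = "\<lambda>X. q * card X"]) auto
    also have "(\<Sum>v\<in>V - ?A. q * card {u \<in> U. dot J v u = \<zero>}) = (\<Sum>v\<in>V - ?A. card U)"
    proof (intro sum.cong refl)
      fix v assume v: "v \<in> V - ?A"
      then obtain u where "u \<in> U" "dot J v u \<noteq> \<zero>" by auto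
      moreover have "v \<in> J \<rightarrow> carrier R" using v lin_subspaceD(1)[OF V] by (auto simp: PiE_iff)
      ultimately show "q * card {u \<in> U. dot J v u = \<zero>} = card U"
        using card_dot_zero[OF fin U] by simp
    qed
    also have "(\<Sum>v\<in>V - ?A. card U) + (\<Sum>v\<in>?A. card U) = card V * card U"
      using finV sum.subset_diff[of ?A V "\<lambda>_. card U"] by simp
    ultimately show ?thesis by (simp add: sum_distrib_left algebra_simps)
  qed
  have finU: "finite U" and finV: "finite V"
    using lin_subspace_finite[OF fin] U V by auto
  have comm: "dot J v u = dot J u v" if "u \<in> U" "v \<in> V" for u v
    using that lin_subspaceD(1)[OF U] lin_subspaceD(1)[OF V]
    by (intro dot_commute) (auto simp: PiE_iff)
  define a where "a = card {v \<in> V. \<forall>u\<in>U. dot J v u = \<zero>} * card U"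
  define b where "b = card {u \<in> U. \<forall>v\<in>V. dot J v u = \<zero>} * card V"
  have b': "b = card {u \<in> U. \<forall>v\<in>V. dot J u v = \<zero>} * card V"
    unfolding b_def using comm
    by (intro arg_cong2[where f = "(*)"] arg_cong[where f = card] refl Collect_cong) auto
  have "(\<Sum>v\<in>V. card {u \<in> U. dot J v u = \<zero>}) = (\<Sum>u\<in>U. card {v \<in> V. dot J v u = \<zero>})"
    using finU finV sum.swap_restrict[of V U "\<lambda>_ _. 1::nat" "\<lambda>v u. dot J v u = \<zero>"] by simp
  also have "\<dots> = (\<Sum>u\<in>U. card {v \<in> V. dot J u v = \<zero>})"
    using comm by (intro sum.cong refl arg_cong[where f = card]) auto
  finally have "q * a + b = q * b + a"
    using gen[OF U V] gen[OF V U] unfolding a_def b' by (simp add: algebra_simps)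
  then have "(int q - 1) * (int a - int b) = 0"
    by (simp add: algebra_simps flip: of_nat_mult)
  then have "a = b" using q_ge_2 by simp
  then show ?thesis unfolding a_def b_def .
qed

section \<open>Rank and kernel\<close>

definition mat_row :: "nat \<Rightarrow> (nat \<times> nat \<Rightarrow> 'a) \<Rightarrow> nat \<Rightarrow> nat \<Rightarrow> 'a" where
  "mat_row n A i = (\<lambda>j\<in>{1..n}. A (i, j))"

definition null :: "nat \<Rightarrow> nat \<Rightarrow> (nat \<times> nat \<Rightarrow> 'a) \<Rightarrow> (nat \<Rightarrow> 'a) set" where
  "null m n A = {x \<in> vecs {1..n}. \<forall>i\<in>{1..m}. dot {1..n} (mat_row n A i) x = \<zero>}"

lemma mat_row_closed:
  "A \<in> matrices R m n \<Longrightarrow> i \<in> {1..m} \<Longrightarrow> mat_row n A i \<in> vecs {1..n}"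
  unfolding matrices_def mat_row_def by (auto simp: PiE_iff)

lemma vecs_imp_Pi: "x \<in> vecs J \<Longrightarrow> x \<in> J \<rightarrow> carrier R"
  by (auto simp: PiE_iff)

lemma lin_subspace_null:
  assumes "A \<in> matrices R m n"
  shows "lin_subspace {1..n} (null m n A)"
  using mat_row_closed[OF assms] unfolding lin_subspace_def null_def
  by (auto simp: comb_closed vecs_imp_Pi dot_comb dot_zero)

end

lemma (in vectorspace) card_eq_power_dim:
  assumes fin: "finite (carrier V)"
  shows "card (carrier V) = card (carrier K) ^ dim"
proof -
  have "gen_set (carrier V)"
    using in_own_span[of "carrier V"] span_closed[of "carrier V"] by auto
  then have "fin_dim" unfolding fin_dim_def using fin by blast
  then obtain B where B: "finite B" "basis B" using finite_basis_exists by blast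
  then have BV: "B \<subseteq> carrier V" unfolding basis_def by simp
  have uniq: "\<forall>v. v \<in> carrier V \<longrightarrow> (\<exists>!a. a \<in> B \<rightarrow>\<^sub>E carrier K \<and> lincomb a B = v)"
    using basis_criterion[OF B(1) BV] B(2) by blast
  have closed: "lincomb a B \<in> carrier V" if "a \<in> B \<rightarrow>\<^sub>E carrier K" for a
    using that BV by (intro lincomb_closed) auto
  have "bij_betw (\<lambda>a. lincomb a B) (B \<rightarrow>\<^sub>E carrier K) (carrier V)"
    unfolding bij_betw_def inj_on_def
  proof (intro conjI ballI impI equalityI subsetI)
    fix a b assume "a \<in> B \<rightarrow>\<^sub>E carrier K" "b \<in> B \<rightarrow>\<^sub>E carrier K" "lincomb a B = lincomb b B"
    then show "a = b" using uniq closed by metis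
  next
    fix v assume "v \<in> (\<lambda>a. lincomb a B) ` (B \<rightarrow>\<^sub>E carrier K)"
    then show "v \<in> carrier V" using closed by blast
  next
    fix v assume "v \<in> carrier V"
    then obtain a where "a \<in> B \<rightarrow>\<^sub>E carrier K" "lincomb a B = v" using uniq by metis
    then show "v \<in> (\<lambda>a. lincomb a B) ` (B \<rightarrow>\<^sub>E carrier K)" by blast
  qed
  then have "card (carrier V) = card (B \<rightarrow>\<^sub>E carrier K)" by (simp add: bij_betw_same_card)
  also have "\<dots> = card (carrier K) ^ card B" using B(1) by (simp add: card_PiE)
  finally show ?thesis using dim_basis[OF B] by simp
qed

text \<open>The index sets are written \<open>{1..n}\<close>; rewriting them to \<open>{Suc 0..n}\<close> would keep the facts below
  from matching.\<close>

declare One_nat_def [simp del]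

context finite_field
begin

text \<open>Rank and nullity, stated for cardinalities: the map \<open>x \<mapsto> A x\<close> has the column space as its
  image, and that space has \<open>q\<close> to the rank of \<open>A\<close> elements. From here on ranks are compared
  through the sizes of kernels, and dimensions do not occur any more.\<close>

lemma card_null_times_rank:
  assumes A: "A \<in> matrices R m n"
  shows "card (null m n A) * q ^ mat_rank R m n A = q ^ n"
proof -
  let ?I = "{1..m}" and ?J = "{1..n}"
  define W where "W = func_space ?I"
  interpret W: Module.module R W unfolding W_def by (rule func_space_is_module)
  interpret W: vectorspace R W ..
  have W_simps: "carrier W = ?I \<rightarrow>\<^sub>E carrier R" "\<zero>\<^bsub>W\<^esub> = (\<lambda>i\<in>?I. \<zero>)"
    "\<And>f g. f \<oplus>\<^bsub>W\<^esub> g = (\<lambda>i\<in>?I. f i \<oplus> g i)" "\<And>c f. c \<odot>\<^bsub>W\<^esub> f = (\<lambda>i\<in>?I. c \<otimes> f i)"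
    unfolding W_def func_space_def by simp_all
  define T where "T x = (\<lambda>i\<in>?I. dot ?J (mat_row n A i) x)" for x
  have row: "mat_row n A i \<in> ?J \<rightarrow> carrier R" if "i \<in> ?I" for i
    using mat_row_closed[OF A that] by (auto simp: PiE_iff)
  have T_comb: "T (comb ?J a x y) = (\<lambda>i\<in>?I. a \<otimes> T x i \<oplus> T y i)"
    if "a \<in> carrier R" "x \<in> vecs ?J" "y \<in> vecs ?J" for a x y
    unfolding T_def using that row by (intro restrict_ext) (auto simp: dot_comb vecs_imp_Pi)
  have T_closed: "T x \<in> carrier W" if "x \<in> vecs ?J" for x
    unfolding T_def W_simps restrict_PiE_iff using vecs_imp_Pi[OF that] row by (intro ballI dot_closed)
  have col: "mat_column m A j = T (unit_vec ?J j)" if "j \<in> ?J" for j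
    unfolding T_def mat_column_def using that row
    by (intro restrict_ext) (auto simp: dot_unit_vec, auto simp: mat_row_def)
  have cols: "mat_column m A ` ?J \<subseteq> carrier W"
    using col T_closed unit_vec_closed by auto
  let ?S = "W.span (mat_column m A ` ?J)"
  have sub: "submodule R ?S W" using cols by (rule W.span_is_submodule)
  have image: "T ` vecs ?J = ?S"
  proof (rule equalityI)
    have "submodule R (T ` vecs ?J) W"
    proof (unfold_locales)
      show "T ` vecs ?J \<subseteq> carrier W" using T_closed by auto
      show "\<zero>\<^bsub>W\<^esub> \<in> T ` vecs ?J"
      proof
        show "\<zero>\<^bsub>W\<^esub> = T (\<lambda>j\<in>?J. \<zero>)"
          unfolding T_def W_simps using row by (intro restrict_ext) (simp add: dot_zero)
      qed simp
    next
      fix a v assume "a \<in> carrier R" "v \<in> T ` vecs ?J"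
      then obtain x where x: "a \<in> carrier R" "x \<in> vecs ?J" "v = T x" by auto
      have "T (comb ?J a x (\<lambda>j\<in>?J. \<zero>)) = a \<odot>\<^bsub>W\<^esub> v"
        unfolding W_simps x(3) using x row
        by (subst T_comb) (auto simp: T_def dot_zero dot_closed vecs_imp_Pi intro!: restrict_ext)
      then show "a \<odot>\<^bsub>W\<^esub> v \<in> T ` vecs ?J"
        using comb_closed[OF x(1,2), of "\<lambda>j\<in>?J. \<zero>"] by (metis imageI restrict_PiE_iff zero_closed)
    next
      fix v w assume "v \<in> T ` vecs ?J" "w \<in> T ` vecs ?J"
      then obtain x y where x: "x \<in> vecs ?J" "v = T x" "y \<in> vecs ?J" "w = T y" by auto
      have "T (comb ?J \<one> x y) = v \<oplus>\<^bsub>W\<^esub> w"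
        unfolding W_simps x(2,4) using x row
        by (subst T_comb) (auto simp: T_def dot_closed vecs_imp_Pi intro!: restrict_ext)
      then show "v \<oplus>\<^bsub>W\<^esub> w \<in> T ` vecs ?J"
        using comb_closed[OF one_closed x(1,3)] by (metis imageI)
    qed
    moreover have "mat_column m A ` ?J \<subseteq> T ` vecs ?J"
      using col unit_vec_closed by auto
    ultimately show "?S \<subseteq> T ` vecs ?J" by (intro W.span_is_subset)
  next
    interpret S: submodule R ?S W by (rule sub)
    have *: "(\<lambda>i\<in>?I. dot J (mat_row n A i) x) \<in> ?S" if x: "x \<in> vecs ?J" and "finite J" "J \<subseteq> ?J" for x J
      using that(2,3)
    proof (induction J)
      case empty
      have "(\<lambda>i\<in>?I. dot {} (mat_row n A i) x) = \<zero>\<^bsub>W\<^esub>"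
        unfolding dot_def W_simps by simp
      then show ?case using W.span_zero by simp
    next
      case (insert j J)
      have j: "j \<in> ?J" "x j \<in> carrier R" using insert x by (auto simp: PiE_iff)
      have "mat_column m A j \<in> ?S" using cols j by (intro W.span_mem) auto
      then have "x j \<odot>\<^bsub>W\<^esub> mat_column m A j \<in> ?S" using j(2) by (rule S.smult_closed[rotated])
      moreover have "(\<lambda>i\<in>?I. dot J (mat_row n A i) x) \<in> ?S"
        by (rule insert.IH) (use insert.prems in simp)
      ultimately have "x j \<odot>\<^bsub>W\<^esub> mat_column m A j \<oplus>\<^bsub>W\<^esub> (\<lambda>i\<in>?I. dot J (mat_row n A i) x) \<in> ?S"
        by (rule S.m_closed)
      also have "x j \<odot>\<^bsub>W\<^esub> mat_column m A j \<oplus>\<^bsub>W\<^esub> (\<lambda>i\<in>?I. dot J (mat_row n A i) x)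
          = (\<lambda>i\<in>?I. dot (insert j J) (mat_row n A i) x)"
        unfolding W_simps
      proof (rule restrict_ext)
        fix i assume i: "i \<in> ?I"
        have row_J: "mat_row n A i \<in> insert j J \<rightarrow> carrier R"
          using row[OF i] insert.prems by (auto simp: Pi_iff)
        have x_J: "x \<in> insert j J \<rightarrow> carrier R" using x insert.prems by (auto simp: PiE_iff)
        have "dot (insert j J) (mat_row n A i) x = mat_row n A i j \<otimes> x j \<oplus> dot J (mat_row n A i) x"
          using dot_remove[of "insert j J" j "mat_row n A i" x] row_J x_J insert by simp
        moreover have "mat_row n A i j = A (i, j)" "A (i, j) \<in> carrier R"
          using j row_J by (auto simp: mat_row_def Pi_iff)
        ultimately show "(\<lambda>i\<in>?I. x j \<otimes> mat_column m A j i) i \<oplus> (\<lambda>i\<in>?I. dot J (mat_row n A i) x) i =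
            dot (insert j J) (mat_row n A i) x"
          using i j by (simp add: mat_column_def m_comm)
      qed
      finally show ?case .
    qed
    show "T ` vecs ?J \<subseteq> ?S"
      unfolding T_def using * by auto
  qed
  have "VectorSpace.subspace R ?S W" using cols by (rule W.span_is_subspace)
  then interpret S: vectorspace R "W.vs ?S" by (rule W.subspace_is_vs)
  have "finite (T ` vecs ?J)" using finite_carrier by (simp add: finite_PiE)
  then have "card (T ` vecs ?J) = q ^ mat_rank R m n A"
    using S.card_eq_power_dim image unfolding mat_rank_def W_def by simp
  moreover have "card (vecs ?J) = card (T ` vecs ?J) * card (null m n A)"
  proof (rule card_eq_image_times_kernel)
    show "finite ?J" "lin_subspace ?J (vecs ?J)" by (simp_all add: lin_subspace_vecs)
    show "null m n A \<subseteq> vecs ?J" unfolding null_def by auto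
    fix x u assume xu: "x \<in> vecs ?J" "u \<in> vecs ?J"
    then have "comb ?J (\<ominus> \<one>) u x \<in> null m n A \<longleftrightarrow>
      (\<forall>i\<in>?I. dot ?J (mat_row n A i) x = dot ?J (mat_row n A i) u)"
      unfolding null_def using row by (auto simp: comb_closed dot_diff_eq_zero_iff)
    moreover have "T x = T u \<longleftrightarrow>
      (\<forall>i\<in>?I. dot ?J (mat_row n A i) x = dot ?J (mat_row n A i) u)"
      unfolding T_def by (auto simp: restrict_def fun_eq_iff)
    ultimately show "T x = T u \<longleftrightarrow> comb ?J (\<ominus> \<one>) u x \<in> null m n A" by simp
  qed
  ultimately show ?thesis by (simp add: card_PiE mult.commute)
qed

lemma rank_cong_card_null:
  assumes "A \<in> matrices R m n" "B \<in> matrices R m' n" "card (null m n A) * q ^ k = card (null m' n B)"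
  shows "mat_rank R m n A = mat_rank R m' n B + k"
proof -
  have "card (null m n A) * q ^ mat_rank R m n A = card (null m n A) * q ^ (mat_rank R m' n B + k)"
    using card_null_times_rank[OF assms(1)] card_null_times_rank[OF assms(2)]
    by (simp add: power_add mult.left_commute[of _ "q ^ k"] flip: assms(3))
       (simp add: algebra_simps)
  moreover have "card (null m n A) \<noteq> 0"
    using card_null_times_rank[OF assms(1)] q_ge_2 by (metis mult_0 not_numeral_le_zero power_not_zero)
  ultimately show ?thesis using q_ge_2 by simp
qed

section \<open>Appending a row\<close>

definition append_row :: "nat \<Rightarrow> nat \<Rightarrow> (nat \<times> nat \<Rightarrow> 'a) \<Rightarrow> (nat \<Rightarrow> 'a) \<Rightarrow> nat \<times> nat \<Rightarrow> 'a" where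
  "append_row p n B v = (\<lambda>(i, j)\<in>{1..Suc p} \<times> {1..n}. if i = Suc p then v j else B (i, j))"

lemma append_row_apply:
  assumes "j \<in> {1..n}"
  shows "append_row p n B v (Suc p, j) = v j" "i \<in> {1..p} \<Longrightarrow> append_row p n B v (i, j) = B (i, j)"
  using assms unfolding append_row_def by auto

lemma append_row_closed:
  assumes "B \<in> matrices R p n" "v \<in> vecs {1..n}"
  shows "append_row p n B v \<in> matrices R (Suc p) n"
  using assms unfolding append_row_def matrices_def
  by (auto simp: PiE_iff extensional_def)

lemma bij_betw_append_row:
  "bij_betw (\<lambda>(B, v). append_row p n B v) (matrices R p n \<times> vecs {1..n}) (matrices R (Suc p) n)"
proof (rule bij_betw_byWitness[where f' =
      "\<lambda>A. (restrict A ({1..p} \<times> {1..n}), mat_row n A (Suc p))"])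
  show "\<forall>a\<in>matrices R p n \<times> vecs {1..n}.
     (restrict (case a of (B, v) \<Rightarrow> append_row p n B v) ({1..p} \<times> {1..n}),
      mat_row n (case a of (B, v) \<Rightarrow> append_row p n B v) (Suc p)) = a"
  proof safe
    fix B v assume "B \<in> matrices R p n" "v \<in> vecs {1..n}"
    then show "restrict (append_row p n B v) ({1..p} \<times> {1..n}) = B"
      "mat_row n (append_row p n B v) (Suc p) = v"
      unfolding mat_row_def append_row_def matrices_def
      by (auto simp: PiE_iff extensional_def intro!: ext)
  qed
  show "\<forall>A\<in>matrices R (Suc p) n.
     (case (restrict A ({1..p} \<times> {1..n}), mat_row n A (Suc p)) of (B, v) \<Rightarrow> append_row p n B v) = A"
    unfolding mat_row_def append_row_def matrices_def
    by (auto simp: PiE_iff extensional_def intro!: ext)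
  show "(\<lambda>(B, v). append_row p n B v) ` (matrices R p n \<times> vecs {1..n}) \<subseteq> matrices R (Suc p) n"
    using append_row_closed by auto
  show "(\<lambda>A. (restrict A ({1..p} \<times> {1..n}), mat_row n A (Suc p))) ` matrices R (Suc p) n
     \<subseteq> matrices R p n \<times> vecs {1..n}"
    unfolding mat_row_def matrices_def by (auto simp: PiE_iff split: if_splits)
qed

lemma null_append_row:
  assumes "B \<in> matrices R p n" "v \<in> vecs {1..n}"
  shows "null (Suc p) n (append_row p n B v) = {x \<in> null p n B. dot {1..n} v x = \<zero>}"
proof -
  have "mat_row n (append_row p n B v) (Suc p) = v"
    using assms(2) unfolding mat_row_def append_row_def
    by (auto simp: PiE_iff extensional_def intro!: ext)
  moreover have "mat_row n (append_row p n B v) i = mat_row n B i" if "i \<in> {1..p}" for i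
    using that unfolding mat_row_def append_row_def by (intro restrict_ext) auto
  ultimately show ?thesis
    unfolding null_def by (auto simp: atLeastAtMostSuc_conv)
qed

text \<open>The row space is the annihilator of the kernel, so the rank stays the same exactly if the new
  row annihilates the kernel. Otherwise the kernel shrinks by a factor \<open>q\<close>.\<close>

lemma rank_append_row:
  assumes B: "B \<in> matrices R p n" and v: "v \<in> vecs {1..n}"
  shows "mat_rank R (Suc p) n (append_row p n B v) =
    (if \<forall>x\<in>null p n B. dot {1..n} v x = \<zero> then mat_rank R p n B else Suc (mat_rank R p n B))"
proof (cases "\<forall>x\<in>null p n B. dot {1..n} v x = \<zero>")
  case True
  then have "{x \<in> null p n B. dot {1..n} v x = \<zero>} = null p n B" by auto
  then show ?thesis
    using True rank_cong_card_null[OF append_row_closed[OF B v] B, of 0] null_append_row[OF B v]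
    by simp
next
  case False
  then obtain x where "x \<in> null p n B" "dot {1..n} v x \<noteq> \<zero>" by auto
  then have "card (null p n B) = q * card {x \<in> null p n B. dot {1..n} v x = \<zero>}"
    using v by (intro card_dot_zero lin_subspace_null B) (auto simp: vecs_imp_Pi)
  then show ?thesis
    using False rank_cong_card_null[OF append_row_closed[OF B v] B, of 1] null_append_row[OF B v]
    by (simp add: mult.commute)
qed

section \<open>Column operations\<close>

definition clear_col :: "nat \<Rightarrow> nat \<Rightarrow> nat \<Rightarrow> (nat \<times> nat \<Rightarrow> 'a) \<Rightarrow> nat \<times> nat \<Rightarrow> 'a" where
  "clear_col m n j A = (\<lambda>(i, k)\<in>{1..m} \<times> {1..n}. if k = j then \<zero> else A (i, k))"

lemma clear_col_closed: "A \<in> matrices R m n \<Longrightarrow> clear_col m n j A \<in> matrices R m n"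
  unfolding clear_col_def matrices_def by (auto simp: PiE_iff extensional_def)

text \<open>If \<open>x\<close> is in the kernel and \<open>x j \<noteq> 0\<close>, then column \<open>j\<close> is a combination of the others, and
  subtracting that combination clears it. In terms of kernels: both contain a vector with
  nonzero entry at \<open>j\<close> (\<open>x\<close> and the unit vector respectively), so the vectors with entry zero at
  \<open>j\<close> form a \<open>q\<close>-th part of each, and on such vectors column \<open>j\<close> has no influence.\<close>

lemma rank_clear_col:
  assumes A: "A \<in> matrices R m n" and x: "x \<in> null m n A" and j: "j \<in> {1..n}" "x j \<noteq> \<zero>"
  shows "mat_rank R m n (clear_col m n j A) = mat_rank R m n A"
proof -
  let ?J = "{1..n}" and ?C = "clear_col m n j A"
  let ?e = "unit_vec ?J j"
  have C: "?C \<in> matrices R m n" by (rule clear_col_closed[OF A])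
  have e: "?e \<in> ?J \<rightarrow> carrier R" using unit_vec_closed by (rule vecs_imp_Pi)
  have row: "mat_row n A i \<in> ?J \<rightarrow> carrier R" "mat_row n ?C i \<in> ?J \<rightarrow> carrier R" if "i \<in> {1..m}" for i
    using mat_row_closed[OF A that] mat_row_closed[OF C that] by (auto simp: PiE_iff)
  have dot_e: "dot ?J ?e y = y j" if "y \<in> vecs ?J" for y
    using that e j by (subst dot_commute) (auto simp: dot_unit_vec vecs_imp_Pi)
  have xJ: "x \<in> vecs ?J" using x by (simp add: null_def)
  have "?e \<in> null m n ?C"
    unfolding null_def using unit_vec_closed j row
    by (auto simp: dot_unit_vec) (auto simp: mat_row_def clear_col_def)
  moreover have "dot ?J ?e ?e \<noteq> \<zero>"
    unfolding dot_e[OF unit_vec_closed] using j by (simp add: unit_vec_def)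
  ultimately have nullC: "card (null m n ?C) = q * card {y \<in> null m n ?C. dot ?J ?e y = \<zero>}"
    using e by (intro card_dot_zero lin_subspace_null C) auto
  have nullA: "card (null m n A) = q * card {y \<in> null m n A. dot ?J ?e y = \<zero>}"
    using e j x xJ by (intro card_dot_zero lin_subspace_null A) (auto simp: dot_e)
  have "dot ?J (mat_row n A i) y = dot ?J (mat_row n ?C i) y"
    if y: "y \<in> vecs ?J" "y j = \<zero>" and i: "i \<in> {1..m}" for y i
  proof -
    have "dot (?J - {j}) (mat_row n A i) y = dot (?J - {j}) (mat_row n ?C i) y"
    proof (rule dot_cong)
      show "mat_row n ?C i \<in> ?J - {j} \<rightarrow> carrier R" "y \<in> ?J - {j} \<rightarrow> carrier R"
        using row(2)[OF i] vecs_imp_Pi[OF y(1)] by auto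
      show "mat_row n A i k = mat_row n ?C i k" if "k \<in> ?J - {j}" for k
        using that i by (simp add: mat_row_def clear_col_def)
    qed
    moreover have "mat_row n A i j \<in> carrier R" "mat_row n ?C i j \<in> carrier R"
      using row[OF i] j by (auto simp: Pi_iff)
    ultimately show ?thesis
      using dot_remove[of ?J j "mat_row n A i" y] dot_remove[of ?J j "mat_row n ?C i" y] row[OF i] y j
      by (simp add: vecs_imp_Pi)
  qed
  then have "{y \<in> null m n A. dot ?J ?e y = \<zero>} = {y \<in> null m n ?C. dot ?J ?e y = \<zero>}"
    unfolding null_def by (auto simp: dot_e)
  then show ?thesis
    using rank_cong_card_null[OF C A, of 0] nullA nullC by simp
qed

section \<open>Counting the possible last rows\<close>

definition constrained :: "nat \<Rightarrow> nat \<Rightarrow> (nat \<times> nat) set \<Rightarrow> nat \<Rightarrow> (nat \<times> nat \<Rightarrow> 'a) set" where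
  "constrained m n S r = {A \<in> matrices R m n. mat_rank R m n A = r \<and> (\<forall>(i, j)\<in>S. A (i, j) = \<zero>)}"

lemma matq_eq_card_constrained: "matq R m n S r = card (constrained m n S r)"
  unfolding matq_def constrained_def ..

lemma finite_matrices: "finite (matrices R m n)"
  unfolding matrices_def by (intro finite_PiE) (auto simp: finite_carrier)

lemma finite_constrained: "finite (constrained m n S r)"
  unfolding constrained_def using finite_matrices by simp

definition supported :: "nat set \<Rightarrow> nat set \<Rightarrow> (nat \<Rightarrow> 'a) set" where
  "supported J Z = {x \<in> vecs J. \<forall>j\<in>J - Z. x j = \<zero>}"

definition exact_support :: "nat set \<Rightarrow> nat set \<Rightarrow> (nat \<Rightarrow> 'a) set" where
  "exact_support J T = {x \<in> vecs J. \<forall>j\<in>J. x j \<noteq> \<zero> \<longleftrightarrow> j \<in> T}"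

lemma card_supported:
  assumes "finite J" "Z \<subseteq> J"
  shows "card (supported J Z) = q ^ card Z"
proof -
  have "supported J Z = (\<Pi>\<^sub>E j\<in>J. if j \<in> Z then carrier R else {\<zero>})"
    unfolding supported_def by (auto simp: PiE_def Pi_iff split: if_splits) (metis zero_closed)
  then have "card (supported J Z) = (\<Prod>j\<in>J. if j \<in> Z then q else 1)"
    using assms(1) by (simp add: card_PiE if_distrib[of card] One_nat_def cong: if_cong)
  also have "\<dots> = q ^ card Z"
    using assms by (simp add: prod.If_cases Int_absorb1)
  finally show ?thesis .
qed

lemma card_exact_support:
  assumes "finite J" "T \<subseteq> J"
  shows "card (exact_support J T) = (q - 1) ^ card T"
proof -
  have "exact_support J T = (\<Pi>\<^sub>E j\<in>J. if j \<in> T then carrier R - {\<zero>} else {\<zero>})"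
    unfolding exact_support_def by (auto simp: PiE_def Pi_iff split: if_splits) (metis zero_closed)
  then have "card (exact_support J T) = (\<Prod>j\<in>J. if j \<in> T then q - 1 else 1)"
    using assms(1) finite_carrier
    by (simp add: card_PiE if_distrib[of card] card_Diff_singleton One_nat_def cong: if_cong)
  also have "\<dots> = (q - 1) ^ card T"
    using assms by (simp add: prod.If_cases Int_absorb1)
  finally show ?thesis .
qed

lemma lin_subspace_supported: "lin_subspace J (supported J Z)"
  unfolding lin_subspace_def supported_def
  by (auto simp: comb_closed) (auto simp: comb_def)

lemma finite_supported: "finite J \<Longrightarrow> finite (supported J Z)"
  by (rule lin_subspace_finite[OF _ lin_subspace_supported])

text \<open>Coordinate subspaces are dual to each other: being orthogonal to all vectors that vanish on \<open>Z\<close>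
  means vanishing outside \<open>Z\<close>.\<close>

lemma supported_annihilator:
  assumes fin: "finite J" and U: "U \<subseteq> vecs J"
  shows "{u \<in> U. \<forall>v\<in>supported J (J - Z). dot J v u = \<zero>} = U \<inter> supported J Z"
proof safe
  fix u assume u: "u \<in> U" "\<forall>v\<in>supported J (J - Z). dot J v u = \<zero>"
  then have uJ: "u \<in> vecs J" using U by auto
  have "u j = \<zero>" if j: "j \<in> J - Z" for j
  proof -
    have e: "unit_vec J j \<in> supported J (J - Z)"
      unfolding supported_def using j unit_vec_closed by (auto simp: unit_vec_def)
    then have "dot J (unit_vec J j) u = \<zero>" using u(2) by auto
    then show ?thesis
      using fin uJ j unit_vec_closed[of J j]
      by (subst (asm) dot_commute) (auto simp: dot_unit_vec vecs_imp_Pi)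
  qed
  then show "u \<in> supported J Z" unfolding supported_def using uJ by auto
next
  fix u v assume uv: "u \<in> U" "u \<in> supported J Z" "v \<in> supported J (J - Z)"
  have "v j \<otimes> u j = \<zero>" if j: "j \<in> J" for j
  proof (cases "j \<in> Z")
    case True
    then show ?thesis using uv j by (auto simp: supported_def PiE_iff)
  next
    case False
    then show ?thesis using uv j by (auto simp: supported_def PiE_iff)
  qed
  then show "dot J v u = \<zero>"
    unfolding dot_def by (intro add.finprod_one_eqI)
qed

text \<open>The rows that vanish on \<open>Z\<close> and can be put below \<open>B\<close> without raising its rank, that is, the
  elements of the row space of \<open>B\<close> that vanish on \<open>Z\<close>.\<close>

definition row_extensions :: "nat \<Rightarrow> nat \<Rightarrow> nat set \<Rightarrow> (nat \<times> nat \<Rightarrow> 'a) \<Rightarrow> (nat \<Rightarrow> 'a) set" where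
  "row_extensions p n Z B =
     {v \<in> supported {1..n} ({1..n} - Z). \<forall>x\<in>null p n B. dot {1..n} v x = \<zero>}"

text \<open>This is \<open>card_annihilator\<close> for the kernel of \<open>B\<close> and the space of rows vanishing on \<open>Z\<close>. It
  trades the row space for the kernel, which is easier to sum over all \<open>B\<close>.\<close>

lemma card_row_extensions:
  assumes B: "B \<in> matrices R p n" and Z: "Z \<subseteq> {1..n}"
  shows "card (row_extensions p n Z B) * q ^ card Z =
    q ^ mat_rank R p n B * card (null p n B \<inter> supported {1..n} Z)"
proof -
  let ?a = "card (row_extensions p n Z B)" and ?k = "card (null p n B \<inter> supported {1..n} Z)"
  let ?s = "mat_rank R p n B"
  have nB: "null p n B \<subseteq> vecs {1..n}" unfolding null_def by auto
  have cZ: "card ({1..n} - Z) + card Z = n"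
    using Z card_mono[OF _ Z] by (simp add: card_Diff_subset finite_subset)
  have "?a * card (null p n B) = ?k * q ^ card ({1..n} - Z)"
    using card_annihilator[OF _ lin_subspace_null[OF B] lin_subspace_supported[of "{1..n}" "{1..n} - Z"]]
    by (simp add: row_extensions_def supported_annihilator[OF _ nB] card_supported)
  then have "(?a * card (null p n B)) * (q ^ ?s * q ^ card Z) = ?k * q ^ card ({1..n} - Z) * (q ^ ?s * q ^ card Z)"
    by simp
  then have "?a * (card (null p n B) * q ^ ?s) * q ^ card Z = ?k * (q ^ card ({1..n} - Z) * q ^ card Z) * q ^ ?s"
    by (simp only: mult_ac)
  then have "?a * q ^ card Z * q ^ n = q ^ ?s * ?k * q ^ n"
    unfolding card_null_times_rank[OF B] power_add[symmetric] cZ by (simp add: mult_ac)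
  then show ?thesis using q_ge_2 by simp
qed

lemma sum_rank_split:
  fixes f g :: "(nat \<times> nat \<Rightarrow> 'a) \<Rightarrow> nat"
  assumes "finite M"
  shows "(\<Sum>B\<in>M. if rk B = r then f B else if Suc (rk B) = r then g B else 0) =
    (\<Sum>B\<in>{B \<in> M. rk B = r}. f B) + (\<Sum>B\<in>{B \<in> M. Suc (rk B) = r}. g B)"
proof -
  have "(\<Sum>B\<in>M. if rk B = r then f B else if Suc (rk B) = r then g B else 0) =
    (\<Sum>B\<in>M. (if rk B = r then f B else 0) + (if Suc (rk B) = r then g B else 0))"
    by (intro sum.cong) auto
  then show ?thesis using assms by (simp add: sum.distrib sum.inter_filter)
qed

text \<open>A matrix of rank \<open>r\<close> arises from its first \<open>p\<close> rows \<open>B\<close> in one of two ways: \<open>B\<close> has rank \<open>r\<close>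
  and the last row lies in the row space of \<open>B\<close>, or \<open>B\<close> has rank \<open>r - 1\<close> and it does not.\<close>

lemma matq_Suc:
  assumes S: "S \<subseteq> {1..Suc p} \<times> {1..n}"
  defines "Z \<equiv> {j. (Suc p, j) \<in> S}" and "S' \<equiv> S \<inter> {1..p} \<times> {1..n}"
  shows "int (matq R (Suc p) n S r) = (\<Sum>B\<in>constrained p n S' r. int (card (row_extensions p n Z B))) +
    (if r = 0 then 0 else int q ^ (n - card Z) * int (matq R p n S' (r - 1))
       - (\<Sum>B\<in>constrained p n S' (r - 1). int (card (row_extensions p n Z B))))"
proof -
  let ?J = "{1..n}"
  define V where "V = supported ?J (?J - Z)"
  define M where "M = {B \<in> matrices R p n. \<forall>(i, j)\<in>S'. B (i, j) = \<zero>}"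
  define rk where "rk = mat_rank R p n"
  have Z: "Z \<subseteq> ?J" using S unfolding Z_def by auto
  have finV: "finite V" unfolding V_def by (simp add: finite_supported)
  have cardV: "card V = q ^ (n - card Z)"
    unfolding V_def using Z by (simp add: card_supported card_Diff_subset finite_subset)
  have finM: "finite M" unfolding M_def using finite_matrices by simp
  have V: "V \<subseteq> vecs ?J" unfolding V_def supported_def by auto
  have ext_V: "row_extensions p n Z B \<subseteq> V" for B
    unfolding row_extensions_def V_def by auto
  have zero_iff: "(\<forall>(i, j)\<in>S. append_row p n B v (i, j) = \<zero>) \<longleftrightarrow>
      (\<forall>(i, j)\<in>S'. B (i, j) = \<zero>) \<and> v \<in> V" if v: "v \<in> vecs ?J" for B v
  proof -
    have split: "S = S' \<union> {Suc p} \<times> Z"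
      using S unfolding S'_def Z_def by (auto simp: atLeastAtMostSuc_conv)
    have "v \<in> V \<longleftrightarrow> (\<forall>j\<in>Z. v j = \<zero>)"
      using v Z unfolding V_def supported_def by auto
    moreover have "append_row p n B v (Suc p, j) = v j" if "j \<in> Z" for j
      using that Z append_row_apply(1) by blast
    moreover have "append_row p n B v (i, j) = B (i, j)" if "(i, j) \<in> S'" for i j
      using that unfolding S'_def by (intro append_row_apply(2)) auto
    ultimately show ?thesis unfolding split by (auto simp: ball_Un)
  qed
  have inj: "inj_on (\<lambda>(B, v). append_row p n B v) (matrices R p n \<times> vecs ?J)"
    and surj: "(\<lambda>(B, v). append_row p n B v) ` (matrices R p n \<times> vecs ?J) = matrices R (Suc p) n"
    using bij_betw_append_row unfolding bij_betw_def by auto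
  let ?P = "SIGMA B:M. {v \<in> V. mat_rank R (Suc p) n (append_row p n B v) = r}"
  have "constrained (Suc p) n S r = (\<lambda>(B, v). append_row p n B v) ` ?P"
  proof (intro equalityI subsetI)
    fix A assume A: "A \<in> constrained (Suc p) n S r"
    then have "A \<in> (\<lambda>(B, v). append_row p n B v) ` (matrices R p n \<times> vecs ?J)"
      unfolding surj constrained_def by simp
    then obtain B v where Bv: "B \<in> matrices R p n" "v \<in> vecs ?J" "A = append_row p n B v"
      by (auto elim!: imageE)
    have "mat_rank R (Suc p) n A = r" "\<forall>(i, j)\<in>S. A (i, j) = \<zero>"
      using A unfolding constrained_def by simp_all
    then have "(B, v) \<in> ?P"
      using zero_iff[OF Bv(2), of B] Bv(1) unfolding Bv(3) M_def by simp
    then show "A \<in> (\<lambda>(B, v). append_row p n B v) ` ?P"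
      using Bv(3) by (intro image_eqI[of _ _ "(B, v)"]) simp_all
  next
    fix A assume "A \<in> (\<lambda>(B, v). append_row p n B v) ` ?P"
    then obtain B v where Bv: "B \<in> M" "v \<in> V" "mat_rank R (Suc p) n (append_row p n B v) = r"
        "A = append_row p n B v" by auto
    have B: "B \<in> matrices R p n" "\<forall>(i, j)\<in>S'. B (i, j) = \<zero>" and v: "v \<in> vecs ?J"
      using Bv(1,2) V unfolding M_def by auto
    show "A \<in> constrained (Suc p) n S r"
      using append_row_closed[OF B(1) v] zero_iff[OF v, of B] B(2) Bv(2,3)
      unfolding Bv(4) constrained_def by simp
  qed
  moreover have "inj_on (\<lambda>(B, v). append_row p n B v) ?P"
    by (rule inj_on_subset[OF inj]) (use V in \<open>auto simp: M_def\<close>)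
  ultimately have "matq R (Suc p) n S r = card ?P"
    unfolding matq_eq_card_constrained by (simp add: card_image)
  also have "\<dots> = (\<Sum>B\<in>M. card {v \<in> V. mat_rank R (Suc p) n (append_row p n B v) = r})"
    using finM finV by (intro card_SigmaI) auto
  also have "\<dots> = (\<Sum>B\<in>M. if rk B = r then card (row_extensions p n Z B)
      else if Suc (rk B) = r then card V - card (row_extensions p n Z B) else 0)"
  proof (intro sum.cong refl)
    fix B assume "B \<in> M"
    then have B: "B \<in> matrices R p n" unfolding M_def by auto
    have "mat_rank R (Suc p) n (append_row p n B v) =
        (if v \<in> row_extensions p n Z B then rk B else Suc (rk B))" if "v \<in> V" for v
    proof -
      have "v \<in> vecs ?J" using that V by auto
      then show ?thesis
        using rank_append_row[OF B, of v] that unfolding rk_def row_extensions_def V_def by auto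
    qed
    then have "{v \<in> V. mat_rank R (Suc p) n (append_row p n B v) = r} =
      (if rk B = r then row_extensions p n Z B
       else if Suc (rk B) = r then V - row_extensions p n Z B else {})"
      using ext_V[of B] by (auto split: if_splits)
    then show "card {v \<in> V. mat_rank R (Suc p) n (append_row p n B v) = r} =
      (if rk B = r then card (row_extensions p n Z B)
       else if Suc (rk B) = r then card V - card (row_extensions p n Z B) else 0)"
      using ext_V[of B] finV by (auto simp: card_Diff_subset finite_subset)
  qed
  also have "\<dots> = (\<Sum>B\<in>{B \<in> M. rk B = r}. card (row_extensions p n Z B)) +
      (\<Sum>B\<in>{B \<in> M. Suc (rk B) = r}. card V - card (row_extensions p n Z B))"
    by (rule sum_rank_split[OF finM])
  also have "{B \<in> M. rk B = r} = constrained p n S' r"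
    unfolding M_def rk_def constrained_def by auto
  also have "{B \<in> M. Suc (rk B) = r} = (if r = 0 then {} else constrained p n S' (r - 1))"
    unfolding M_def rk_def constrained_def by auto
  finally show ?thesis
    using card_mono[OF finV ext_V]
    by (simp add: sum_subtractf of_nat_diff cardV matq_eq_card_constrained mult.commute)
qed

section \<open>Kernel vectors with prescribed support\<close>

text \<open>Counting the pairs \<open>(B, x)\<close> with \<open>B x = 0\<close> by \<open>x\<close> instead of \<open>B\<close>, sorted by the support of \<open>x\<close>.\<close>

lemma sum_card_null_supported:
  assumes Z: "Z \<subseteq> {1..n}" and C: "finite C"
  shows "(\<Sum>B\<in>C. card (null p n B \<inter> supported {1..n} Z)) =
    (\<Sum>T\<in>Pow Z. \<Sum>x\<in>exact_support {1..n} T. card {B \<in> C. x \<in> null p n B})"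
proof -
  let ?J = "{1..n}"
  have fin: "finite (supported ?J Z)" by (simp add: finite_supported)
  have finZ: "finite Z" using Z finite_subset by blast
  have union: "supported ?J Z = (\<Union>T\<in>Pow Z. exact_support ?J T)"
  proof (intro equalityI subsetI)
    fix x assume x: "x \<in> supported ?J Z"
    then have "x \<in> exact_support ?J {j \<in> ?J. x j \<noteq> \<zero>}" "{j \<in> ?J. x j \<noteq> \<zero>} \<in> Pow Z"
      unfolding supported_def exact_support_def by auto
    then show "x \<in> (\<Union>T\<in>Pow Z. exact_support ?J T)" by blast
  qed (auto simp: supported_def exact_support_def)
  have disj: "exact_support ?J T \<inter> exact_support ?J T' = {}" if "T \<subseteq> Z" "T' \<subseteq> Z" "T \<noteq> T'" for T T'
  proof -
    have "\<exists>j\<in>Z. (j \<in> T) \<noteq> (j \<in> T')" using that by blast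
    then obtain j where "j \<in> ?J" "(j \<in> T) \<noteq> (j \<in> T')" using Z by blast
    then show ?thesis unfolding exact_support_def by blast
  qed
  have "(\<Sum>B\<in>C. card (null p n B \<inter> supported ?J Z)) =
      (\<Sum>B\<in>C. card {x \<in> supported ?J Z. x \<in> null p n B})"
    by (intro sum.cong refl arg_cong[where f = card]) auto
  also have "\<dots> = (\<Sum>x\<in>supported ?J Z. card {B \<in> C. x \<in> null p n B})"
    using C fin sum.swap_restrict[of C "supported ?J Z" "\<lambda>_ _. 1::nat" "\<lambda>B x. x \<in> null p n B"] by simp
  also have "\<dots> = (\<Sum>T\<in>Pow Z. \<Sum>x\<in>exact_support ?J T. card {B \<in> C. x \<in> null p n B})"
    unfolding union using finZ fin union disj
    by (intro sum.UNION_disjoint) (auto intro: finite_subset)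
  finally show ?thesis .
qed

end

text \<open>The zero pattern after column \<open>Min T\<close> has been cleared with the help of the other columns in
  \<open>T\<close>: the cleared column is zero throughout, and the zeros prescribed in it pass to the others.
  Taking the minimum fixes the choice of a column independently of the field. For \<open>T = {}\<close> nothing
  is to be cleared.\<close>

definition merge_columns :: "nat \<Rightarrow> (nat \<times> nat) set \<Rightarrow> nat set \<Rightarrow> (nat \<times> nat) set" where
  "merge_columns p S T = (if T = {} then S
     else S \<union> {1..p} \<times> {Min T} \<union> {(i, k). k \<in> T \<and> (i, Min T) \<in> S})"

lemma merge_columns_subset:
  assumes "S \<subseteq> {1..p} \<times> {1..n}" "T \<subseteq> {1..n}"
  shows "merge_columns p S T \<subseteq> {1..p} \<times> {1..n}"
proof (cases "T = {}")
  case False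
  have "finite T" using assms(2) finite_subset by blast
  then have "Min T \<in> T" using False by simp
  then show ?thesis using assms unfolding merge_columns_def by auto
qed (use assms in \<open>simp add: merge_columns_def\<close>)

context finite_field
begin

text \<open>Clearing a column \<open>j\<close> in the support of \<open>x\<close> loses no information, because \<open>B x = 0\<close> allows column
  \<open>j\<close> to be restored from the others. Where at most one other column \<open>k\<close> is involved, column \<open>j\<close>
  is a nonzero multiple of column \<open>k\<close> or is zero, so an entry of column \<open>j\<close> vanishes if and only
  if the entry of column \<open>k\<close> in the same row does. This is what makes the conditions on column
  \<open>j\<close> expressible as a zero pattern again, and it fails for supports with three elements. The
  resulting count depends on \<open>x\<close> through \<open>T\<close> alone.\<close>

lemma card_constrained_null:
  assumes S: "S \<subseteq> {1..p} \<times> {1..n}" and T: "T \<subseteq> {1..n}" "card T \<le> 2"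
    and x: "x \<in> exact_support {1..n} T"
  shows "card {B \<in> constrained p n S s. x \<in> null p n B} = matq R p n (merge_columns p S T) s"
proof (cases "T = {}")
  case True
  let ?J = "{1..n}"
  have x0: "x = (\<lambda>j\<in>?J. \<zero>)"
    using x True unfolding exact_support_def by (auto simp: PiE_iff extensional_def intro!: ext)
  have "x \<in> null p n B" if "B \<in> matrices R p n" for B
    using lin_subspaceD(2)[OF lin_subspace_null[OF that]] x0 by simp
  then have "{B \<in> constrained p n S s. x \<in> null p n B} = constrained p n S s"
    unfolding constrained_def by auto
  then show ?thesis using True by (simp add: matq_eq_card_constrained merge_columns_def)
next
  case False
  let ?J = "{1..n}" and ?I = "{1..p}"
  define j where "j = Min T"
  have finT: "finite T" using T finite_subset by blast
  have jT: "j \<in> T" unfolding j_def using False finT by simp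
  have jJ: "j \<in> ?J" using jT T by auto
  have xJ: "x \<in> vecs ?J" and xT: "\<And>k. k \<in> ?J \<Longrightarrow> x k \<noteq> \<zero> \<longleftrightarrow> k \<in> T"
    using x unfolding exact_support_def by auto
  have xj: "x j \<in> Units R" "x j \<in> carrier R" "x j \<noteq> \<zero>"
    using xT[OF jJ] jT xJ jJ by (auto simp: field_Units PiE_iff)
  have T_cases: "T = {j} \<or> (\<exists>k. k \<noteq> j \<and> T = {j, k})"
  proof -
    have "card (T - {j}) \<le> 1" using T(2) finT jT by simp
    then have "T - {j} = {} \<or> (\<exists>k. T - {j} = {k})"
      using finT by (metis card_1_singletonE card_0_eq finite_Diff le_less less_one)
    then show ?thesis using jT by auto
  qed
  let ?S = "merge_columns p S T"
  have S_eq: "?S = S \<union> ?I \<times> {j} \<union> {(i, k). k \<in> T \<and> (i, j) \<in> S}"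
    using False unfolding merge_columns_def j_def by simp
  define d where "d C i = dot (?J - {j}) (mat_row n C i) x" for C i
  \<comment> \<open>The inverse of clearing column \<open>j\<close>: solve \<open>C x = 0\<close> for that column.\<close>
  define fill where "fill C = (\<lambda>(i, k)\<in>?I \<times> ?J. if k = j then \<ominus> (inv (x j) \<otimes> d C i) else C (i, k))" for C
  have x_off: "x \<in> ?J - {j} \<rightarrow> carrier R" using vecs_imp_Pi[OF xJ] by auto
  have row: "mat_row n C i \<in> ?J \<rightarrow> carrier R" "mat_row n C i \<in> ?J - {j} \<rightarrow> carrier R"
    if "C \<in> matrices R p n" "i \<in> ?I" for C i
    using mat_row_closed[OF that] by (auto simp: PiE_iff)
  have d_closed: "d C i \<in> carrier R" if "C \<in> matrices R p n" "i \<in> ?I" for C i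
    unfolding d_def using row[OF that] x_off by (intro dot_closed)
  have split_row: "dot ?J (mat_row n C i) x = C (i, j) \<otimes> x j \<oplus> d C i"
    if "C \<in> matrices R p n" "i \<in> ?I" for C i
    using dot_remove[OF _ jJ row(1)[OF that] vecs_imp_Pi[OF xJ]] jJ unfolding d_def
    by (simp add: mat_row_def)
  have entry: "C (i, k) \<in> carrier R" if "C \<in> matrices R p n" "i \<in> ?I" "k \<in> ?J" for C i k
    using that unfolding matrices_def by auto
  have fill_closed: "fill C \<in> matrices R p n" if C: "C \<in> matrices R p n" for C
    unfolding matrices_def fill_def using d_closed[OF C] entry[OF C] xj
    by (auto simp: PiE_iff)
  have d_cong: "d C i = d C' i"
    if "C' \<in> matrices R p n" "i \<in> ?I" "\<And>k. k \<in> ?J - {j} \<Longrightarrow> C (i, k) = C' (i, k)" for C C' i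
    unfolding d_def using row(2)[OF that(1,2)] x_off that(3)
    by (intro dot_cong) (auto simp: mat_row_def)
  have solve: "a \<otimes> x j \<oplus> b = \<zero> \<longleftrightarrow> a = \<ominus> (inv (x j) \<otimes> b)"
    if "a \<in> carrier R" "b \<in> carrier R" for a b
  proof
    assume "a \<otimes> x j \<oplus> b = \<zero>"
    then have "a \<otimes> x j = \<ominus> b" using that xj by (simp add: add.inv_equality[symmetric])
    then have "a \<otimes> x j \<otimes> inv (x j) = \<ominus> b \<otimes> inv (x j)" by simp
    moreover have "a \<otimes> x j \<otimes> inv (x j) = a" using that xj by (simp add: m_assoc)
    ultimately show "a = \<ominus> (inv (x j) \<otimes> b)"
      using that xj by (simp add: l_minus m_comm[of b])
  next
    assume a: "a = \<ominus> (inv (x j) \<otimes> b)"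
    have "inv (x j) \<otimes> b \<otimes> x j = b" using that xj
      by (metis Units_inv_closed Units_l_inv m_assoc m_comm r_one m_lcomm)
    then show "a \<otimes> x j \<oplus> b = \<zero>" using that xj unfolding a by (simp add: l_minus l_neg)
  qed
  have null_iff: "x \<in> null p n C \<longleftrightarrow> (\<forall>i\<in>?I. C (i, j) = \<ominus> (inv (x j) \<otimes> d C i))"
    if C: "C \<in> matrices R p n" for C
  proof -
    have "dot ?J (mat_row n C i) x = \<zero> \<longleftrightarrow> C (i, j) = \<ominus> (inv (x j) \<otimes> d C i)" if "i \<in> ?I" for i
      unfolding split_row[OF C that] by (rule solve[OF entry[OF C that jJ] d_closed[OF C that]])
    then show ?thesis unfolding null_def using xJ by simp
  qed
  have fill_apply: "fill C (i, k) = C (i, k)" if "i \<in> ?I" "k \<in> ?J - {j}" for C i k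
    using that unfolding fill_def by auto
  have fill_apply_j: "fill C (i, j) = \<ominus> (inv (x j) \<otimes> d C i)" if "i \<in> ?I" for C i
    using that jJ unfolding fill_def by auto
  have clear_apply: "clear_col p n j C (i, k) = C (i, k)" if "i \<in> ?I" "k \<in> ?J - {j}" for C i k
    using that unfolding clear_col_def by auto
  have clear_apply_j: "clear_col p n j C (i, j) = \<zero>" if "i \<in> ?I" for C i
    using that jJ unfolding clear_col_def by auto
  have fill_null: "x \<in> null p n (fill C)" if C: "C \<in> matrices R p n" for C
    using d_cong[OF C, of _ "fill C"] by (simp add: null_iff[OF fill_closed[OF C]] fill_apply_j fill_apply)
  have clear_fill: "clear_col p n j (fill C) = C"
    if C: "C \<in> matrices R p n" and z: "\<And>i. i \<in> ?I \<Longrightarrow> C (i, j) = \<zero>" for C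
  proof
    fix e show "clear_col p n j (fill C) e = C e"
      using C z unfolding clear_col_def fill_def matrices_def
      by (cases e) (auto simp: PiE_iff extensional_def)
  qed
  have fill_clear: "fill (clear_col p n j B) = B" if B: "B \<in> matrices R p n" "x \<in> null p n B" for B
  proof
    fix e
    have "d (clear_col p n j B) i = d B i" if "i \<in> ?I" for i
      using B(1) that by (intro d_cong) (auto simp: clear_apply)
    then have "fill (clear_col p n j B) (i, k) = B (i, k)" if "i \<in> ?I" "k \<in> ?J" for i k
      using that B by (cases "k = j") (auto simp: null_iff fill_apply fill_apply_j clear_apply)
    moreover have "fill (clear_col p n j B) e = B e" if "e \<notin> ?I \<times> ?J"
      using that PiE_arb[OF B(1)[unfolded matrices_def] that] unfolding fill_def by simp
    ultimately show "fill (clear_col p n j B) e = B e" by (cases e) auto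
  qed
  \<comment> \<open>A kernel relation between at most two columns identifies their zero entries.\<close>
  have zero_iff: "(\<forall>(i, k)\<in>S. B (i, k) = \<zero>) \<longleftrightarrow> (\<forall>(i, k)\<in>?S. clear_col p n j B (i, k) = \<zero>)"
    if B: "B \<in> matrices R p n" "x \<in> null p n B" for B
  proof -
    have key: "B (i, j) = \<zero> \<longleftrightarrow> (\<forall>k\<in>T - {j}. B (i, k) = \<zero>)" if i: "i \<in> ?I" for i
    proof -
      have d: "B (i, j) = \<zero> \<longleftrightarrow> d B i = \<zero>"
      proof -
        have "B (i, j) \<otimes> x j \<oplus> d B i = \<zero>"
          using B i null_iff[OF B(1)] solve entry[OF B(1) i jJ] d_closed[OF B(1) i] by auto
        moreover have "B (i, j) \<otimes> x j = \<zero> \<longleftrightarrow> B (i, j) = \<zero>"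
          using xj entry[OF B(1) i jJ] by (auto simp: integral_iff)
        ultimately show ?thesis
          using xj entry[OF B(1) i jJ] d_closed[OF B(1) i]
          by (metis l_zero m_closed r_zero zero_closed)
      qed
      have "d B i = \<zero> \<longleftrightarrow> (\<forall>k\<in>T - {j}. B (i, k) = \<zero>)"
        using T_cases
      proof
        assume T1: "T = {j}"
        have "mat_row n B i k \<otimes> x k = \<zero>" if "k \<in> ?J - {j}" for k
          using that xT[of k] entry[OF B(1) i, of k] T1 by (simp add: mat_row_def)
        then have "d B i = \<zero>" unfolding d_def dot_def by (rule add.finprod_one_eqI)
        then show ?thesis using T1 by simp
      next
        assume "\<exists>k. k \<noteq> j \<and> T = {j, k}"
        then obtain k where k: "k \<noteq> j" "T = {j, k}" by auto
        have kJ: "k \<in> ?J" using k T by auto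
        have "d B i = mat_row n B i k \<otimes> x k \<oplus> dot (?J - {j} - {k}) (mat_row n B i) x"
          unfolding d_def using row(2)[OF B(1) i] x_off k kJ by (intro dot_remove) auto
        also have "dot (?J - {j} - {k}) (mat_row n B i) x = \<zero>"
          unfolding dot_def
        proof (rule add.finprod_one_eqI)
          show "mat_row n B i l \<otimes> x l = \<zero>" if "l \<in> ?J - {j} - {k}" for l
            using that xT[of l] entry[OF B(1) i, of l] k by (simp add: mat_row_def)
        qed
        finally have "d B i = B (i, k) \<otimes> x k"
          using entry[OF B(1) i kJ] kJ xJ by (auto simp: mat_row_def PiE_iff)
        moreover have "x k \<noteq> \<zero>" "x k \<in> carrier R" using xT[OF kJ] k xJ kJ by (auto simp: PiE_iff)
        ultimately show ?thesis using k entry[OF B(1) i kJ] by (auto simp: integral_iff)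
      qed
      then show ?thesis using d by simp
    qed
    show ?thesis
    proof
      assume L: "\<forall>(i, k)\<in>S. B (i, k) = \<zero>"
      have "clear_col p n j B (i, k) = \<zero>" if ik: "(i, k) \<in> ?S" for i k
      proof (cases "k = j")
        case True
        have "i \<in> ?I" using ik merge_columns_subset[OF S T(1)] by auto
        then show ?thesis using True clear_apply_j by simp
      next
        case False
        have IJ: "i \<in> ?I" "k \<in> ?J" using ik merge_columns_subset[OF S T(1)] by auto
        have "B (i, k) = \<zero>"
          using ik L False key[OF IJ(1)] unfolding S_eq by auto
        then show ?thesis using IJ False clear_apply by simp
      qed
      then show "\<forall>(i, k)\<in>?S. clear_col p n j B (i, k) = \<zero>" by auto
    next
      assume R': "\<forall>(i, k)\<in>?S. clear_col p n j B (i, k) = \<zero>"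
      have off: "B (i, k) = \<zero>" if "(i, k) \<in> ?S" "k \<noteq> j" for i k
      proof -
        have "i \<in> ?I" "k \<in> ?J" using that merge_columns_subset[OF S T(1)] by auto
        then show ?thesis using R' that clear_apply[of i k B] by auto
      qed
      have "B (i, k) = \<zero>" if ik: "(i, k) \<in> S" for i k
      proof (cases "k = j")
        case True
        have i: "i \<in> ?I" using ik S by auto
        have "\<forall>k\<in>T - {j}. B (i, k) = \<zero>" using ik True off unfolding S_eq by auto
        then show ?thesis using True key[OF i] by simp
      next
        case False
        then show ?thesis using off ik unfolding S_eq by auto
      qed
      then show "\<forall>(i, k)\<in>S. B (i, k) = \<zero>" by auto
    qed
  qed
  have col_zero: "C (i, j) = \<zero>" if "C \<in> constrained p n ?S s" "i \<in> ?I" for C i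
    using that unfolding constrained_def S_eq by auto
  have C_mat: "C \<in> matrices R p n" if "C \<in> constrained p n S' s" for C S'
    using that unfolding constrained_def by auto
  have "bij_betw (clear_col p n j) {B \<in> constrained p n S s. x \<in> null p n B} (constrained p n ?S s)"
  proof (rule bij_betw_byWitness[where f' = fill])
    show "\<forall>B\<in>{B \<in> constrained p n S s. x \<in> null p n B}. fill (clear_col p n j B) = B"
      using fill_clear C_mat by auto
    show "\<forall>C\<in>constrained p n ?S s. clear_col p n j (fill C) = C"
      using clear_fill C_mat col_zero by blast
    show "clear_col p n j ` {B \<in> constrained p n S s. x \<in> null p n B} \<subseteq> constrained p n ?S s"
    proof safe
      fix B assume B: "B \<in> constrained p n S s" "x \<in> null p n B"
      show "clear_col p n j B \<in> constrained p n ?S s"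
        using B zero_iff[OF C_mat[OF B(1)] B(2)] rank_clear_col[OF C_mat[OF B(1)] B(2) jJ xj(3)]
          clear_col_closed[OF C_mat[OF B(1)]]
        unfolding constrained_def by auto
    qed
    show "fill ` constrained p n ?S s \<subseteq> {B \<in> constrained p n S s. x \<in> null p n B}"
    proof safe
      fix C assume C: "C \<in> constrained p n ?S s"
      note Cm = C_mat[OF C]
      show "x \<in> null p n (fill C)" by (rule fill_null[OF Cm])
      have "clear_col p n j (fill C) = C" using clear_fill[OF Cm] col_zero[OF C] by blast
      then show "fill C \<in> constrained p n S s"
        using C zero_iff[OF fill_closed[OF Cm] fill_null[OF Cm]] fill_closed[OF Cm]
          rank_clear_col[OF fill_closed[OF Cm] fill_null[OF Cm] jJ xj(3)]
        unfolding constrained_def by auto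
    qed
  qed
  then show ?thesis unfolding matq_eq_card_constrained by (rule bij_betw_same_card)
qed

section \<open>Summing over the upper part of the matrix\<close>

text \<open>For ranks \<open>s \<ge> |Z|\<close> the factor \<open>q ^ s / q ^ |Z|\<close> from \<open>card_row_extensions\<close> is a polynomial in
  \<open>q\<close>. For the smaller ranks, which are \<open>0\<close> and \<open>1\<close> because \<open>|Z| \<le> 2\<close>, separate arguments
  avoid the division.\<close>

lemma sum_row_extensions_large_rank:
  assumes S: "S \<subseteq> {1..p} \<times> {1..n}" and Z: "Z \<subseteq> {1..n}" "card Z \<le> 2" and s: "card Z \<le> s"
  shows "(\<Sum>B\<in>constrained p n S s. card (row_extensions p n Z B)) =
    q ^ (s - card Z) * (\<Sum>T\<in>Pow Z. (q - 1) ^ card T * matq R p n (merge_columns p S T) s)"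
proof -
  let ?C = "constrained p n S s"
  have finZ: "finite Z" using Z finite_subset by blast
  have "(\<Sum>B\<in>?C. card (row_extensions p n Z B)) * q ^ card Z =
      (\<Sum>B\<in>?C. q ^ s * card (null p n B \<inter> supported {1..n} Z))"
    unfolding sum_distrib_right
    by (intro sum.cong refl) (auto simp: card_row_extensions Z constrained_def)
  also have "\<dots> = q ^ s * (\<Sum>T\<in>Pow Z. \<Sum>x\<in>exact_support {1..n} T. card {B \<in> ?C. x \<in> null p n B})"
    unfolding sum_distrib_left[symmetric] sum_card_null_supported[OF Z(1) finite_constrained] ..
  also have "(\<Sum>T\<in>Pow Z. \<Sum>x\<in>exact_support {1..n} T. card {B \<in> ?C. x \<in> null p n B}) =
      (\<Sum>T\<in>Pow Z. (q - 1) ^ card T * matq R p n (merge_columns p S T) s)"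
  proof (intro sum.cong refl)
    fix T assume "T \<in> Pow Z"
    then have T: "T \<subseteq> {1..n}" "card T \<le> 2"
      using Z finZ card_mono[of Z T] by auto
    have "(\<Sum>x\<in>exact_support {1..n} T. card {B \<in> ?C. x \<in> null p n B}) =
        (\<Sum>x\<in>exact_support {1..n} T. matq R p n (merge_columns p S T) s)"
      by (intro sum.cong refl card_constrained_null[OF S T])
    then show "(\<Sum>x\<in>exact_support {1..n} T. card {B \<in> ?C. x \<in> null p n B}) =
        (q - 1) ^ card T * matq R p n (merge_columns p S T) s"
      using T by (simp add: card_exact_support)
  qed
  also have "q ^ s = q ^ (s - card Z) * q ^ card Z"
    using s by (simp flip: power_add)
  finally have "(\<Sum>B\<in>?C. card (row_extensions p n Z B)) * q ^ card Z =
     (q ^ (s - card Z) * (\<Sum>T\<in>Pow Z. (q - 1) ^ card T * matq R p n (merge_columns p S T) s)) * q ^ card Z"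
    by (simp only: mult_ac)
  then show ?thesis using q_ge_2 by simp
qed

lemma card_row_extensions_ge_1:
  assumes "B \<in> matrices R p n"
  shows "card (row_extensions p n Z B) \<ge> 1"
proof -
  have "dot {1..n} (\<lambda>j\<in>{1..n}. \<zero>) x = \<zero>" if "x \<in> null p n B" for x
    using that lin_subspaceD(1)[OF lin_subspace_null[OF assms]]
    by (subst dot_commute) (auto simp: dot_zero vecs_imp_Pi subset_iff)
  then have "(\<lambda>j\<in>{1..n}. \<zero>) \<in> row_extensions p n Z B"
    unfolding row_extensions_def supported_def by auto
  moreover have "finite (row_extensions p n Z B)"
    unfolding row_extensions_def by (simp add: finite_supported)
  ultimately show ?thesis
    by (metis One_nat_def Suc_leI card_gt_0_iff empty_iff)
qed

lemma sum_row_extensions_rank_0: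
  assumes Z: "Z \<subseteq> {1..n}"
  shows "(\<Sum>B\<in>constrained p n S 0. card (row_extensions p n Z B)) = matq R p n S 0"
proof -
  have "card (row_extensions p n Z B) = 1" if B: "B \<in> constrained p n S 0" for B
  proof -
    have Bm: "B \<in> matrices R p n" and rk: "mat_rank R p n B = 0"
      using B unfolding constrained_def by auto
    have "card (row_extensions p n Z B) * q ^ card Z \<le> 1 * card (supported {1..n} Z)"
      unfolding card_row_extensions[OF Bm Z] rk by (simp add: card_mono finite_supported)
    then have "card (row_extensions p n Z B) \<le> 1"
      using q_ge_2 Z by (simp add: card_supported)
    then show ?thesis using card_row_extensions_ge_1[OF Bm, of Z] by simp
  qed
  then show ?thesis by (simp add: matq_eq_card_constrained)
qed

text \<open>The row space of a matrix of rank one is a line. Its vectors vanishing on \<open>Z\<close> are all \<open>q\<close> of them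
  if the columns in \<open>Z\<close> are zero, and only the zero vector otherwise.\<close>

lemma sum_row_extensions_rank_1:
  assumes S: "S \<subseteq> {1..p} \<times> {1..n}" and Z: "Z \<subseteq> {1..n}" "card Z = 2"
  shows "(\<Sum>B\<in>constrained p n S 1. card (row_extensions p n Z B)) =
    matq R p n S 1 + (q - 1) * matq R p n (S \<union> {1..p} \<times> Z) 1"
proof -
  let ?C = "constrained p n S 1" and ?D = "constrained p n (S \<union> {1..p} \<times> Z) 1" and ?J = "{1..n}"
  have DC: "?D \<subseteq> ?C" unfolding constrained_def by auto
  have "card (row_extensions p n Z B) = (if B \<in> ?D then q else 1)" if B: "B \<in> ?C" for B
  proof -
    have Bm: "B \<in> matrices R p n" and rk: "mat_rank R p n B = 1"
      using B unfolding constrained_def by auto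
    have row: "mat_row n B i \<in> ?J \<rightarrow> carrier R" if "i \<in> {1..p}" for i
      using mat_row_closed[OF Bm that] by (rule vecs_imp_Pi)
    have "card (row_extensions p n Z B) * q * q = q * card (null p n B \<inter> supported ?J Z)"
      using card_row_extensions[OF Bm Z(1)] rk Z(2) by (simp add: power2_eq_square)
    then have ext: "card (row_extensions p n Z B) * q = card (null p n B \<inter> supported ?J Z)"
      using q_ge_2 by simp
    show ?thesis
    proof (cases "B \<in> ?D")
      case True
      \<comment> \<open>Then every vector supported on \<open>Z\<close> lies in the kernel.\<close>
      have "x \<in> null p n B" if x: "x \<in> supported ?J Z" for x
      proof -
        have "mat_row n B i j \<otimes> x j = \<zero>" if "i \<in> {1..p}" "j \<in> ?J" for i j
        proof (cases "j \<in> Z")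
          case jZ: True
          then have "B (i, j) = \<zero>" using True that unfolding constrained_def by auto
          then show ?thesis using that x by (auto simp: mat_row_def supported_def PiE_iff)
        next
          case False
          then show ?thesis using that x row[of i] by (auto simp: supported_def Pi_iff)
        qed
        then have "dot ?J (mat_row n B i) x = \<zero>" if "i \<in> {1..p}" for i
          unfolding dot_def using that by (intro add.finprod_one_eqI) auto
        then show ?thesis using x unfolding null_def supported_def by auto
      qed
      then have "null p n B \<inter> supported ?J Z = supported ?J Z" by auto
      then show ?thesis using ext True Z q_ge_2 by (simp add: card_supported power2_eq_square)
    next
      case False
      then obtain i j where ij: "i \<in> {1..p}" "j \<in> Z" "B (i, j) \<noteq> \<zero>"
        using B unfolding constrained_def by auto
      \<comment> \<open>Row \<open>i\<close> alone cuts the vectors supported on \<open>Z\<close> down from \<open>q\<^sup>2\<close> to \<open>q\<close>.\<close>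
      have e: "unit_vec ?J j \<in> supported ?J Z"
        unfolding supported_def using ij unit_vec_closed by (auto simp: unit_vec_def)
      have "dot ?J (mat_row n B i) (unit_vec ?J j) = mat_row n B i j"
        using ij Z row by (intro dot_unit_vec) auto
      then have ne: "dot ?J (mat_row n B i) (unit_vec ?J j) \<noteq> \<zero>"
        using ij Z by (auto simp: mat_row_def)
      have "card (row_extensions p n Z B) * q \<le> card {x \<in> supported ?J Z. dot ?J (mat_row n B i) x = \<zero>}"
        unfolding ext using ij by (intro card_mono) (auto simp: finite_supported null_def)
      moreover have "card (supported ?J Z) = q * card {x \<in> supported ?J Z. dot ?J (mat_row n B i) x = \<zero>}"
        using e ne row[OF ij(1)] by (intro card_dot_zero lin_subspace_supported) auto
      then have "card {x \<in> supported ?J Z. dot ?J (mat_row n B i) x = \<zero>} = q"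
        using Z q_ge_2 by (simp add: card_supported power2_eq_square)
      ultimately have "card (row_extensions p n Z B) \<le> 1" using q_ge_2 by simp
      then show ?thesis using False card_row_extensions_ge_1[OF Bm, of Z] by simp
    qed
  qed
  then have "(\<Sum>B\<in>?C. card (row_extensions p n Z B)) = (\<Sum>B\<in>?C. if B \<in> ?D then q else 1)"
    by (intro sum.cong) auto
  also have "\<dots> = (\<Sum>B\<in>?C. 1 + (if B \<in> ?D then q - 1 else 0))"
    using q_ge_2 by (intro sum.cong) auto
  also have "\<dots> = card ?C + (q - 1) * card {B \<in> ?C. B \<in> ?D}"
    by (simp add: sum.distrib finite_constrained mult.commute flip: sum.inter_filter)
  also have "{B \<in> ?C. B \<in> ?D} = ?D" using DC by auto
  finally show ?thesis by (simp add: matq_eq_card_constrained)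
qed

end

section \<open>Uniform linear combinations over all finite fields\<close>

text \<open>The data of a linear combination have to be chosen before the field. Functions of the field that
  are given by one and the same combination for all finite fields form a module over \<open>\<int>[q]\<close>,
  so that identities valid over each field can be assembled into such a combination.\<close>

type_synonym matq_term = "nat \<times> nat \<times> (nat \<times> nat) set \<times> nat \<times> int poly"

definition smaller_term :: "nat \<Rightarrow> nat \<Rightarrow> matq_term \<Rightarrow> bool" where
  "smaller_term m n = (\<lambda>(m', n', S', r', c).
     m' \<le> m \<and> n' \<le> n \<and> (m', n') \<noteq> (m, n) \<and> S' \<subseteq> {1..m'} \<times> {1..n'})"

definition term_value :: "nat ring \<Rightarrow> matq_term \<Rightarrow> int" where
  "term_value F = (\<lambda>(m', n', S', r', c). poly c (int (card (carrier F))) * int (matq F m' n' S' r'))"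

definition smaller_combination :: "nat \<Rightarrow> nat \<Rightarrow> (nat ring \<Rightarrow> int) \<Rightarrow> bool" where
  "smaller_combination m n f \<longleftrightarrow>
    (\<exists>ts. (\<forall>t\<in>set ts. smaller_term m n t) \<and>
      (\<forall>F. finite_field F \<longrightarrow> f F = (\<Sum>t\<leftarrow>ts. term_value F t)))"

lemma smaller_combination_cong:
  assumes "smaller_combination m n f" "\<And>F. finite_field F \<Longrightarrow> g F = f F"
  shows "smaller_combination m n g"
  using assms unfolding smaller_combination_def by auto

lemma smaller_combination_matq:
  assumes "m' \<le> m" "n' \<le> n" "(m', n') \<noteq> (m, n)" "S \<subseteq> {1..m'} \<times> {1..n'}"
  shows "smaller_combination m n (\<lambda>F. int (matq F m' n' S r))"
  unfolding smaller_combination_def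
  using assms
  by (intro exI[of _ "[(m', n', S, r, 1)]"]) (auto simp: smaller_term_def term_value_def)

lemma smaller_combination_add:
  assumes "smaller_combination m n f" "smaller_combination m n g"
  shows "smaller_combination m n (\<lambda>F. f F + g F)"
proof -
  obtain ts us where
    "\<forall>t\<in>set ts. smaller_term m n t" "\<forall>t\<in>set us. smaller_term m n t"
    "\<And>F. finite_field F \<Longrightarrow> f F = (\<Sum>t\<leftarrow>ts. term_value F t)"
    "\<And>F. finite_field F \<Longrightarrow> g F = (\<Sum>t\<leftarrow>us. term_value F t)"
    using assms unfolding smaller_combination_def by blast
  then show ?thesis
    unfolding smaller_combination_def by (intro exI[of _ "ts @ us"]) auto
qed

lemma smaller_combination_poly_mult:
  assumes "smaller_combination m n f"
  shows "smaller_combination m n (\<lambda>F. poly d (int (card (carrier F))) * f F)"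
proof -
  obtain ts where ts: "\<forall>t\<in>set ts. smaller_term m n t"
    "\<And>F. finite_field F \<Longrightarrow> f F = (\<Sum>t\<leftarrow>ts. term_value F t)"
    using assms unfolding smaller_combination_def by blast
  define scale :: "matq_term \<Rightarrow> matq_term" where
    "scale = (\<lambda>(m', n', S', r', c). (m', n', S', r', d * c))"
  have "smaller_term m n (scale t) = smaller_term m n t"
    and "term_value F (scale t) = poly d (int (card (carrier F))) * term_value F t" for t F
    by (auto simp: scale_def smaller_term_def term_value_def case_prod_beta)
  then show ?thesis
    unfolding smaller_combination_def using ts
    by (intro exI[of _ "map scale ts"]) (simp add: sum_list_const_mult o_def)
qed

lemma smaller_combination_sum:
  assumes "finite I" "\<And>i. i \<in> I \<Longrightarrow> smaller_combination m n (f i)"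
  shows "smaller_combination m n (\<lambda>F. \<Sum>i\<in>I. f i F)"
  using assms
proof (induction I)
  case empty
  show ?case unfolding smaller_combination_def by (intro exI[of _ "[]"]) auto
next
  case (insert i I)
  then show ?case by (simp add: smaller_combination_add)
qed

theorem theorem3p6:
  fixes m n r :: nat and S :: "(nat \<times> nat) set"
  assumes "m \<ge> 1" and "n \<ge> 1"
    and "S \<subseteq> {1..m} \<times> {1..n}"
    and "card {j. (m, j) \<in> S} \<le> 2"
  shows "\<exists>ts :: (nat \<times> nat \<times> (nat \<times> nat) set \<times> nat \<times> int poly) list.
    (\<forall>(m', n', S', r', c) \<in> set ts.
        m' \<le> m \<and> n' \<le> n \<and> (m', n') \<noteq> (m, n) \<and> S' \<subseteq> {1..m'} \<times> {1..n'}) \<and>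
    (\<forall>(q :: nat) (F :: nat ring). primepow q \<longrightarrow> field F \<longrightarrow> card (carrier F) = q \<longrightarrow>
        int (matq F m n S r) =
          (\<Sum>(m', n', S', r', c) \<leftarrow> ts. poly c (int q) * int (matq F m' n' S' r')))"
proof -
  obtain p where m: "m = Suc p" using assms(1) by (cases m) auto
  define Z where "Z = {j. (Suc p, j) \<in> S}"
  define S' where "S' = S \<inter> {1..p} \<times> {1..n}"
  have Z: "Z \<subseteq> {1..n}" "card Z \<le> 2" using assms(3,4) unfolding Z_def m by auto
  have S': "S' \<subseteq> {1..p} \<times> {1..n}" unfolding S'_def by auto
  have finZ: "finite Z" using Z finite_subset by blast
  \<comment> \<open>The number of ways to extend some \<open>B\<close> of rank \<open>s\<close> by an admissible row in its row space.\<close>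
  define \<alpha> where "\<alpha> s F = (\<Sum>B\<in>finite_field.constrained F p n S' s.
      int (card (finite_field.row_extensions F p n Z B)))" for s and F :: "nat ring"
  let ?ok = "smaller_combination (Suc p) n"
  have matq_ok: "?ok (\<lambda>F. int (matq F p n T s))" if "T \<subseteq> {1..p} \<times> {1..n}" for T s
    using that by (intro smaller_combination_matq) auto
  note scale_ok = smaller_combination_poly_mult
  have q_minus_1: "int (card (carrier F) - 1) = poly [:-1, 1:] (int (card (carrier F)))"
    if "finite_field F" for F :: "nat ring"
    using finite_field.q_ge_2[OF that] by (simp add: of_nat_diff)
  have \<alpha>_ok: "?ok (\<alpha> s)" for s
  proof -
    consider "card Z \<le> s" | "s = 0" | "s = 1" "card Z = 2" using Z by linarith
    then show ?thesis
    proof cases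
      case 1
      show ?thesis
      proof (rule smaller_combination_cong)
        show "?ok (\<lambda>F. poly (monom 1 (s - card Z)) (int (card (carrier F))) * (\<Sum>T\<in>Pow Z.
            poly ([:-1, 1:] ^ card T) (int (card (carrier F))) * int (matq F p n (merge_columns p S' T) s)))"
          using finZ Z S'
          by (intro scale_ok smaller_combination_sum matq_ok merge_columns_subset) auto
        fix F :: "nat ring" assume F: "finite_field F"
        show "\<alpha> s F = poly (monom 1 (s - card Z)) (int (card (carrier F))) * (\<Sum>T\<in>Pow Z.
            poly ([:-1, 1:] ^ card T) (int (card (carrier F))) * int (matq F p n (merge_columns p S' T) s))"
          using arg_cong[OF finite_field.sum_row_extensions_large_rank[OF F S' Z 1], of int]
          by (simp add: \<alpha>_def poly_monom q_minus_1[OF F] del: of_nat_diff)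
      qed
    next
      case 2
      show ?thesis
      proof (rule smaller_combination_cong[OF matq_ok[OF S', of 0]])
        fix F :: "nat ring" assume F: "finite_field F"
        show "\<alpha> s F = int (matq F p n S' 0)"
          using arg_cong[OF finite_field.sum_row_extensions_rank_0[OF F Z(1), of p S'], of int]
          by (simp add: \<alpha>_def 2)
      qed
    next
      case 3
      show ?thesis
      proof (rule smaller_combination_cong)
        show "?ok (\<lambda>F. int (matq F p n S' 1) +
          poly [:-1, 1:] (int (card (carrier F))) * int (matq F p n (S' \<union> {1..p} \<times> Z) 1))"
          using S' Z by (intro scale_ok smaller_combination_add matq_ok) auto
        fix F :: "nat ring" assume F: "finite_field F"
        show "\<alpha> s F = int (matq F p n S' 1) +
          poly [:-1, 1:] (int (card (carrier F))) * int (matq F p n (S' \<union> {1..p} \<times> Z) 1)"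
          using arg_cong[OF finite_field.sum_row_extensions_rank_1[OF F S' Z(1) 3(2)], of int]
          by (simp only: \<alpha>_def 3(1) of_nat_add of_nat_mult of_nat_sum q_minus_1[OF F])
      qed
    qed
  qed
  have ok: "?ok (\<lambda>F. int (matq F (Suc p) n S r))"
  proof (cases "r = 0")
    case True
    show ?thesis
    proof (rule smaller_combination_cong[OF \<alpha>_ok[of r]])
      fix F :: "nat ring" assume F: "finite_field F"
      show "int (matq F (Suc p) n S r) = \<alpha> r F"
        using finite_field.matq_Suc[OF F assms(3)[unfolded m]] True
        by (simp add: \<alpha>_def Z_def S'_def)
    qed
  next
    case False
    show ?thesis
    proof (rule smaller_combination_cong)
      show "?ok (\<lambda>F. \<alpha> r F +
        (poly (monom 1 (n - card Z)) (int (card (carrier F))) * int (matq F p n S' (r - 1)) +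
         poly (-1) (int (card (carrier F))) * \<alpha> (r - 1) F))"
        using S' by (intro smaller_combination_add scale_ok \<alpha>_ok matq_ok)
      fix F :: "nat ring" assume F: "finite_field F"
      show "int (matq F (Suc p) n S r) = \<alpha> r F +
        (poly (monom 1 (n - card Z)) (int (card (carrier F))) * int (matq F p n S' (r - 1)) +
         poly (-1) (int (card (carrier F))) * \<alpha> (r - 1) F)"
        using finite_field.matq_Suc[OF F assms(3)[unfolded m]] False
        by (simp add: \<alpha>_def Z_def S'_def poly_monom)
    qed
  qed
  have ff: "finite_field F" if "primepow (card (carrier F))" "field F" for F :: "nat ring"
    using that primepow_gt_0_nat[of "card (carrier F)"]
    unfolding finite_field_def finite_field_axioms_def by (auto simp: card_gt_0_iff)
  obtain ts where ts: "\<forall>t\<in>set ts. smaller_term m n t"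
    "\<And>F. finite_field F \<Longrightarrow> int (matq F m n S r) = (\<Sum>t\<leftarrow>ts. term_value F t)"
    using ok unfolding smaller_combination_def m by blast
  show ?thesis
    using ts ff unfolding smaller_term_def term_value_def by (intro exI[of _ ts]) auto
qed

end
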